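(* Let $\Sigma$ be a simplicial fan in $\mathbb{R}^d$ with $n$ rays and ray matrix $U\in\mathbb{R}^{n\times d}$, and let $J\in\Sigma^c$ be a primitive collection. For $\rho\in J$, let $\tau_\rho\in\Sigma(|J|-1)$ be the cone generated by $J\setminus\{\rho\}$. The intersection ${\rm Sing}(\mathcal{A}_\Sigma)\cap\Lambda_J$ is given by the $2\cdot|J|$ equations $$x_\rho=0\quad\text{and}\quad\Big(\prod_{\rho'\notin{\rm nb}(\tau_\rho),\ \rho'\notin J}x_{\rho'}\Big)\cdot{\rm Adj}_{\Sigma_{\tau_\rho},U_{\tau_\rho}}=0\qquad\text{for all }\rho\in J.$$ In particular, if $\Sigma$ is the normal fan of a simple $d$-dimensional polytope $P\subset\mathbb{R}^d$, then $J$ is a set of facets of $P$; for $Q\in J$ let $\Delta_Q=\bigcap_{Q'\in J\setminus\{Q\}}Q'$. The variety ${\rm Sing}(\mathcal{A}_P)\cap\Lambda_J$ is given by $$x_Q=0\quad\text{and}\quad\Big(\prod_{Q'\cap\Delta_Q=\emptyset,\ Q'\notin J}x_{Q'}\Big)\cdot{\rm Adj}_{\Delta_Q,U_{\Delta_Q}}=0\qquad\text{for all }Q\in J.$$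
   Context: A simplicial fan $\Sigma$ is a (finite) polyhedral fan whose cones are generated by linearly independent vectors. $\Sigma(k)$ is the set of $k$-dimensional cones, $\sigma(1)$ the set of rays of $\sigma$, $n=|\Sigma(1)|$. A ray matrix $U\in\mathbb{R}^{n\times d}$, assumed of rank $d$, has rows $u_\rho$, $\rho\in\Sigma(1)$, with $u_\rho$ a nonzero generator of $\rho$. For $\sigma\in\Sigma(d)$, $U_\sigma$ is the submatrix with rows indexed by $\sigma(1)$. The universal adjoint is ${\rm Adj}_{\Sigma,U}(x)=\sum_{\sigma\in\Sigma(d)}|\det U_\sigma|\prod_{\rho\notin\sigma(1)}x_\rho$. $\mathbb{P}^{n-1}$ is complex projective space with homogeneous coordinates $x_\rho$; $\mathcal{A}_\Sigma=\{x\in\mathbb{P}^{n-1}:{\rm Adj}_{\Sigma,U}(x)=0\}$, ${\rm Sing}(\mathcal{A}_\Sigma)=\{x\in\mathbb{P}^{n-1}:\partial{\rm Adj}_{\Sigma,U}/\partial x_\rho(x)=0\text{ for all }\rho\in\Sigma(1)\}$. $\Sigma^c$ is the set of subsets of $\Sigma(1)$ not contained in a cone of $\Sigma$; primitive collections are its inclusion-minimal elements. $\Lambda_J=\{x\in\mathbb{P}^{n-1}:x_\rho=0\text{ for all }\rho\in J\}$. For $\tau\in\Sigma(k)$: ${\rm nb}(\tau)=\{\rho\in\Sigma(1):\tau(1)\cup\{\rho\}=\sigma(1)\text{ for some }\sigma\in\Sigma(k+1)\}$. The star fan $\Sigma_\tau$ consists of the images $\overline{\sigma}$ in $\mathbb{R}^d/{\rm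 span}_{\mathbb{R}}(\tau)$ of all $\sigma\in\Sigma$ having $\tau$ as a face; its rays are $\overline{\rho}$, $\rho\in{\rm nb}(\tau)$, and one identifies $x_{\overline{\rho}}=x_\rho$. Choose an invertible $d\times d$ matrix $T_\tau$ such that the rows of $U\cdot T_\tau$ labeled by $\tau(1)$ are the standard basis vectors $e_1,\ldots,e_k$. $U_\tau$ is the submatrix of $U\cdot T_\tau$ consisting of the last $d-k$ columns and the rows indexed by ${\rm nb}(\tau)$; its rows generate the rays of $\Sigma_\tau$ in $\mathbb{R}^{d-k}$. ${\rm Adj}_{\Sigma_\tau,U_\tau}$ is formed from $\Sigma_\tau,U_\tau$ by the same formula, in the variables $x_\rho$, $\rho\in{\rm nb}(\tau)$; it is $0$ if $\Sigma_\tau$ has no $(d-k)$-dimensional cones, and it is $1$ if $k=d$ (empty determinant). When $\Sigma=\Sigma_P$ is the inner normal fan of $P$, rays of $\Sigma$ are identified with facets of $P$, and $\mathcal{A}_P=\mathcal{A}_{\Sigma_P}$. For a face $\Delta\subseteq P$ of codimension $k$ with normal cone $\sigma_\Delta\in\Sigma(k)$ (generated by the rays of the facets containing $\Delta$), $U_\Delta=U_{\sigma_\Delta}$ in the star-fan sense just defined (last $d-k$ columns of $U\cdot T_{\sigma_\Delta}$; rows indexed by the facets $Q$ such that $Q\cap\Delta$ is a facet of $\Delta$), and ${\rm Adj}_{\Delta,U_\Delta}={\rm Adj}_{\Sigma_{\sigma_\Delta},U_\Delta}$, where $\Sigma_{\sigma_\Delta}$ is the normal fan of $\Delta$. *)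

theory Defs
  imports "HOL-Analysis.Analysis" "Jordan_Normal_Form.Determinant"
begin

no_notation Matrix.vec_index (infixl \<open>$\<close> 100)

text \<open>Since \<^term>\<open>{}\<close> counts as a face in the library, nonemptiness of faces is explicit.\<close>

definition polyhedral_fan :: "(real^'d) set set \<Rightarrow> bool" where
  "polyhedral_fan \<Sigma> \<longleftrightarrow> finite \<Sigma> \<and> \<Sigma> \<noteq> {} \<and>
     (\<forall>\<sigma>\<in>\<Sigma>. \<exists>S. finite S \<and> \<sigma> = convex_cone hull S) \<and>
     (\<forall>\<sigma>\<in>\<Sigma>. \<forall>\<tau>. \<tau> face_of \<sigma> \<and> \<tau> \<noteq> {} \<longrightarrow> \<tau> \<in> \<Sigma>) \<and>
     (\<forall>\<sigma>\<in>\<Sigma>. \<forall>\<tau>\<in>\<Sigma>. (\<sigma> \<inter> \<tau>) face_of \<sigma> \<and> (\<sigma> \<inter> \<tau>) face_of \<tau>)"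

definition simplicial_fan :: "(real^'d) set set \<Rightarrow> bool" where
  "simplicial_fan \<Sigma> \<longleftrightarrow> polyhedral_fan \<Sigma> \<and>
     (\<forall>\<sigma>\<in>\<Sigma>. \<exists>B. independent B \<and> \<sigma> = convex_cone hull B)"

definition fan_cones :: "(real^'d) set set \<Rightarrow> nat \<Rightarrow> (real^'d) set set" where
  "fan_cones \<Sigma> k = {\<sigma> \<in> \<Sigma>. dim \<sigma> = k}"

definition ray :: "real^'d^'n \<Rightarrow> 'n \<Rightarrow> (real^'d) set" where
  "ray U i = convex_cone hull {U $ i}"

text \<open>The rays of \<open>\<Sigma>\<close> are labelled by the row type of \<open>U\<close>; sets of rays are represented
  by sets of labels throughout.\<close>

definition ray_matrix :: "(real^'d) set set \<Rightarrow> real^'d^'n \<Rightarrow> bool" where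
  "ray_matrix \<Sigma> U \<longleftrightarrow> bij_betw (ray U) UNIV (fan_cones \<Sigma> 1) \<and>
     (\<forall>i. U $ i \<noteq> 0) \<and> rank U = CARD('d)"

text \<open>The labels of \<open>\<sigma>(1)\<close>, for rays labelled by \<open>I\<close>.\<close>

definition ray_labels :: "real^'d^'n \<Rightarrow> 'n set \<Rightarrow> (real^'d) set \<Rightarrow> 'n set" where
  "ray_labels U I \<sigma> = {i \<in> I. ray U i face_of \<sigma>}"

definition nb :: "(real^'d) set set \<Rightarrow> real^'d^'n \<Rightarrow> (real^'d) set \<Rightarrow> 'n set" where
  "nb \<Sigma> U \<tau> = {i. \<exists>\<sigma>\<in>fan_cones \<Sigma> (dim \<tau> + 1).
     ray_labels U UNIV \<tau> \<union> {i} = ray_labels U UNIV \<sigma>}"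

definition fan_nonfaces :: "(real^'d) set set \<Rightarrow> real^'d^'n \<Rightarrow> 'n set set" where
  "fan_nonfaces \<Sigma> U = {J. \<not> (\<exists>\<sigma>\<in>\<Sigma>. J \<subseteq> ray_labels U UNIV \<sigma>)}"

definition primitive_collection :: "(real^'d) set set \<Rightarrow> real^'d^'n \<Rightarrow> 'n set \<Rightarrow> bool" where
  "primitive_collection \<Sigma> U J \<longleftrightarrow>
     J \<in> fan_nonfaces \<Sigma> U \<and> (\<forall>J'. J' \<subset> J \<longrightarrow> J' \<notin> fan_nonfaces \<Sigma> U)"

definition cone_over :: "real^'d^'n \<Rightarrow> 'n set \<Rightarrow> (real^'d) set" where
  "cone_over U J = convex_cone hull (($) U ` J)"

text \<open>Absolute value of the minor with rows \<open>R\<close> and columns \<open>C\<close>, where \<open>card R = card C\<close>.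
  It does not depend on the chosen enumerations of \<open>R\<close> and \<open>C\<close>.\<close>

definition abs_minor :: "real^'d^'n \<Rightarrow> 'n set \<Rightarrow> 'd set \<Rightarrow> real" where
  "abs_minor A R C =
     (let r = (SOME r. distinct r \<and> set r = R); c = (SOME c. distinct c \<and> set c = C)
      in \<bar>Determinant.det (Matrix.mat (card C) (card C) (\<lambda>(i, j). A $ (r ! i) $ (c ! j)))\<bar>)"

text \<open>To have one definition for a fan in \<open>\<real>\<^sup>d\<close> and for its star fans, which live in spaces of smaller
  (possibly zero) dimension, \<open>\<real>\<^sup>C\<close> is identified for \<open>C \<subseteq> 'd\<close> with the subspace of those vectors whose
  coordinates outside \<open>C\<close> vanish. In \<open>adj \<Sigma> A I C\<close>, the fan \<open>\<Sigma>\<close> lives in \<open>\<real>\<^sup>C\<close>, and its ray matrix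
  consists of the rows \<open>I\<close> and columns \<open>C\<close> of \<open>A\<close>; the other entries of \<open>A\<close> are \<open>0\<close>.\<close>

definition adj ::
  "(real^'d) set set \<Rightarrow> real^'d^'n \<Rightarrow> 'n set \<Rightarrow> 'd set \<Rightarrow> complex^'n \<Rightarrow> complex" where
  "adj \<Sigma> A I C x =
     (\<Sum>\<sigma>\<in>fan_cones \<Sigma> (card C).
        of_real (abs_minor A (ray_labels A I \<sigma>) C) * (\<Prod>i\<in>I - ray_labels A I \<sigma>. x $ i))"

definition submatrix :: "'n set \<Rightarrow> 'd set \<Rightarrow> real^'d^'n \<Rightarrow> real^'d^'n" where
  "submatrix I C A = (\<chi> i j. if i \<in> I \<and> j \<in> C then A $ i $ j else 0)"

abbreviation universal_adjoint ::
  "(real^'d) set set \<Rightarrow> real^'d^'n \<Rightarrow> complex^'n \<Rightarrow> complex" where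
  "universal_adjoint \<Sigma> U \<equiv> adj \<Sigma> U UNIV UNIV"

text \<open>The columns \<open>K\<close> play the role of the first \<open>k\<close> columns, and \<open>- K\<close> that of the last \<open>d - k\<close>.\<close>

definition adapted ::
  "real^'d^'n \<Rightarrow> (real^'d) set \<Rightarrow> real^'d^'d \<Rightarrow> 'd set \<Rightarrow> bool" where
  "adapted U \<tau> T K \<longleftrightarrow> invertible T \<and>
     bij_betw (\<lambda>i. (U ** T) $ i) (ray_labels U UNIV \<tau>) ((\<lambda>j. axis j 1) ` K)"

text \<open>The map \<open>v \<mapsto> v T\<close> followed by keeping the columns \<open>- K\<close>. If \<open>T, K\<close> are adapted to \<open>\<tau>\<close>, its kernel
  is the span of \<open>\<tau>\<close> (see below), so that it identifies the quotient by that span with \<open>\<real>\<^sup>-\<^sup>K\<close>.\<close>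

definition star_map :: "real^'d^'d \<Rightarrow> 'd set \<Rightarrow> real^'d \<Rightarrow> real^'d" where
  "star_map T K v = (\<chi> j. if j \<in> K then 0 else (v v* T) $ j)"

lemma star_map_eq_0_iff:
  fixes U :: "real^'d^'n"
  assumes "adapted U \<tau> T K"
  shows "star_map T K v = 0 \<longleftrightarrow> v \<in> span (($) U ` ray_labels U UNIV \<tau>)"
proof -
  let ?f = "\<lambda>v::real^'d. v v* T"
  let ?R = "($) U ` ray_labels U UNIV \<tau>"
  have lin: "linear ?f"
    using matrix_vector_mul_linear[of "transpose T"] by (simp add: transpose_matrix_vector)
  obtain T' where T': "T ** T' = Finite_Cartesian_Product.mat 1"
    using assms by (auto simp: adapted_def invertible_def)
  have inj: "inj ?f"
    by (rule inj_on_inverseI[where g = "\<lambda>w. w v* T'"])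
       (simp add: vector_matrix_mul_assoc T')
  have row: "(U ** T) $ i = ?f (U $ i)" for i
    by (simp add: matrix_matrix_mult_def vector_matrix_mult_def Finite_Cartesian_Product.vec_eq_iff mult.commute)
  have "?f ` ?R = (\<lambda>j. axis j 1) ` K"
    using assms by (simp add: adapted_def bij_betw_def row image_image)
  then have fR: "?f ` span ?R = span ((\<lambda>j. axis j 1) ` K)"
    using linear_span_image[OF lin, of ?R] by simp
  have sp: "w \<in> span ((\<lambda>j. axis j 1) ` K) \<longleftrightarrow> (\<forall>j. j \<notin> K \<longrightarrow> w $ j = 0)" for w :: "real^'d"
  proof
    assume "w \<in> span ((\<lambda>j. axis j 1) ` K)"
    then show "\<forall>j. j \<notin> K \<longrightarrow> w $ j = 0"
      by (induction rule: span_induct_alt) (auto simp: axis_def split: if_splits)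
  next
    assume w: "\<forall>j. j \<notin> K \<longrightarrow> w $ j = 0"
    have "w = (\<Sum>j\<in>K. (w $ j) *\<^sub>R axis j 1)"
      using w by (simp add: Finite_Cartesian_Product.vec_eq_iff axis_def if_distrib[of "\<lambda>t. _ * t"] cong: if_cong)
    also have "\<dots> \<in> span ((\<lambda>j. axis j 1) ` K)"
      by (intro span_sum span_scale span_base) auto
    finally show "w \<in> span ((\<lambda>j. axis j 1) ` K)" .
  qed
  have "star_map T K v = 0 \<longleftrightarrow> ?f v \<in> ?f ` span ?R"
    unfolding fR sp by (auto simp: star_map_def Finite_Cartesian_Product.vec_eq_iff)
  then show ?thesis using inj_image_mem_iff[OF inj, of v "span ?R"] by simp
qed

definition star_fan ::
  "(real^'d) set set \<Rightarrow> (real^'d) set \<Rightarrow> real^'d^'d \<Rightarrow> 'd set \<Rightarrow> (real^'d) set set" where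
  "star_fan \<Sigma> \<tau> T K = (\<lambda>\<sigma>. star_map T K ` \<sigma>) ` {\<sigma> \<in> \<Sigma>. \<tau> face_of \<sigma>}"

definition star_adjoint ::
  "(real^'d) set set \<Rightarrow> real^'d^'n \<Rightarrow> (real^'d) set \<Rightarrow> real^'d^'d \<Rightarrow> 'd set \<Rightarrow> complex^'n \<Rightarrow> complex" where
  "star_adjoint \<Sigma> U \<tau> T K =
     adj (star_fan \<Sigma> \<tau> T K) (submatrix (nb \<Sigma> U \<tau>) (- K) (U ** T)) (nb \<Sigma> U \<tau>) (- K)"

definition proj_space :: "(complex^'n) set set" where
  "proj_space = {L. vec.subspace L \<and> vec.dim L = 1}"

text \<open>The nonzero elements of a point of projective space are its homogeneous coordinate vectors.
  All functions below are homogeneous polynomials, so one coordinate vector decides.\<close>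

definition zero_locus :: "(complex^'n \<Rightarrow> complex) set \<Rightarrow> (complex^'n) set set" where
  "zero_locus E = {p \<in> proj_space. \<forall>x\<in>p - {0}. \<forall>f\<in>E. f x = 0}"

definition partial_deriv :: "'n \<Rightarrow> (complex^'n \<Rightarrow> complex) \<Rightarrow> complex^'n \<Rightarrow> complex" where
  "partial_deriv i f x = deriv (\<lambda>t. f (\<chi> j. if j = i then t else x $ j)) (x $ i)"

definition sing_adjoint :: "(real^'d) set set \<Rightarrow> real^'d^'n \<Rightarrow> (complex^'n) set set" where
  "sing_adjoint \<Sigma> U = zero_locus {partial_deriv i (universal_adjoint \<Sigma> U) | i. True}"

definition coord_subspace :: "'n set \<Rightarrow> (complex^'n) set set" where
  "coord_subspace J = zero_locus {(\<lambda>x. x $ i) | i. i \<in> J}"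

definition simple_polytope :: "(real^'d) set \<Rightarrow> bool" where
  "simple_polytope P \<longleftrightarrow> polytope P \<and>
     (\<forall>v. v extreme_point_of P \<longrightarrow> int (card {F. F facet_of P \<and> v \<in> F}) = aff_dim P)"

definition normal_cone :: "(real^'d) set \<Rightarrow> (real^'d) set \<Rightarrow> (real^'d) set" where
  "normal_cone P F = {u. \<forall>x\<in>F. \<forall>y\<in>P. u \<bullet> x \<le> u \<bullet> y}"

definition normal_fan :: "(real^'d) set \<Rightarrow> (real^'d) set set" where
  "normal_fan P = normal_cone P ` {F. F face_of P \<and> F \<noteq> {}}"

text \<open>The identification of rays of the normal fan with facets.\<close>

definition ray_facet :: "(real^'d) set \<Rightarrow> real^'d^'n \<Rightarrow> 'n \<Rightarrow> (real^'d) set" where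
  "ray_facet P U i = (THE Q. Q facet_of P \<and> normal_cone P Q = ray U i)"

text \<open>The face obtained by intersecting all facets in \<open>J\<close> but \<open>q\<close>.\<close>

definition cofacet :: "(real^'d) set \<Rightarrow> real^'d^'n \<Rightarrow> 'n set \<Rightarrow> 'n \<Rightarrow> (real^'d) set" where
  "cofacet P U J q = (\<Inter>q'\<in>J - {q}. ray_facet P U q')"

definition face_nb :: "(real^'d) set \<Rightarrow> real^'d^'n \<Rightarrow> (real^'d) set \<Rightarrow> 'n set" where
  "face_nb P U \<Delta> = {i. (ray_facet P U i \<inter> \<Delta>) facet_of \<Delta>}"

definition face_adjoint ::
  "(real^'d) set \<Rightarrow> real^'d^'n \<Rightarrow> (real^'d) set \<Rightarrow> real^'d^'d \<Rightarrow> 'd set \<Rightarrow> complex^'n \<Rightarrow> complex" where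
  "face_adjoint P U \<Delta> T K =
     adj (star_fan (normal_fan P) (normal_cone P \<Delta>) T K)
         (submatrix (face_nb P U \<Delta>) (- K) (U ** T)) (face_nb P U \<Delta>) (- K)"

end

theory Submission
  imports Defs
begin

text \<open>Adj is multilinear. At a point where \<open>x\<^sub>\<rho> = 0\<close> for all \<open>\<rho> \<in> J\<close>, the term of a maximal cone \<open>\<sigma>\<close>
  in the partial derivative with respect to \<open>x\<^sub>\<rho>\<close> vanishes unless \<open>J \<subseteq> \<sigma>(1) \<union> {\<rho>}\<close>. As \<open>J\<close> is not
  contained in \<open>\<sigma>(1)\<close>, this forces \<open>\<rho> \<in> J\<close> and \<open>\<tau>\<^sub>\<rho> \<subseteq> \<sigma>\<close>, so that exactly the maximal cones of the star of
  \<open>\<tau>\<^sub>\<rho>\<close> remain. In coordinates adapted to \<open>\<tau>\<^sub>\<rho>\<close> the matrix of such a cone is block triangular with an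
  identity block, whence its determinant is, up to the factor \<open>det T\<close>, the one of its image in the star
  fan. Removing the factors \<open>x\<^sub>\<rho>\<^sub>'\<close> common to all terms leaves the adjoint of the star fan. For a polytope,
  \<open>F \<mapsto> normal_cone P F\<close> reverses inclusions, which translates rays and neighbours into
  facets and their intersections.\<close>

section \<open>Minors\<close>

text \<open>Two duplicate-free lists of the same set differ by a permutation, which multiplies the
  determinant by its sign only.\<close>

lemma abs_det_reorder_rows:
  fixes f :: "'a \<Rightarrow> nat \<Rightarrow> real"
  assumes "distinct r" "distinct r'" "set r = set r'" "length r = n"
  shows "\<bar>Determinant.det (Matrix.mat n n (\<lambda>(i, j). f (r ! i) j))\<bar> =
         \<bar>Determinant.det (Matrix.mat n n (\<lambda>(i, j). f (r' ! i) j))\<bar>"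
proof -
  have "mset r' = mset r"
    using assms by (simp add: set_eq_iff_mset_eq_distinct)
  then obtain p where p: "p permutes {..<length r}" "permute_list p r = r'"
    using mset_eq_permutation by metis
  let ?A = "Matrix.mat n n (\<lambda>(i, j). f (r ! i) j)"
  have p': "p permutes {0..<n}"
    using p assms by (simp add: lessThan_atLeast0)
  have "Matrix.mat n n (\<lambda>(i, j). f (r' ! i) j) = Matrix.mat n n (\<lambda>(i, j). ?A $$ (p i, j))"
    using p assms p' permutes_in_image[OF p'] by (intro eq_matI) (auto simp: permute_list_nth)
  moreover have "Determinant.det (Matrix.mat n n (\<lambda>(i, j). ?A $$ (p i, j))) = signof p * Determinant.det ?A"
    by (rule det_permute_rows) (use p' in auto)
  moreover have "\<bar>signof p :: real\<bar> = 1"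
    by (cases rule: sign_cases[of p]) simp_all
  ultimately show ?thesis
    by (simp add: abs_mult)
qed

text \<open>Replaces the enumerations chosen by \<open>SOME\<close> in \<open>abs_minor\<close> by
  any convenient ones. All later computations of minors pick lists that give the matrix a useful
  shape.\<close>

lemma abs_minor_eq:
  fixes A :: "real^'d^'n"
  assumes "distinct r" "set r = R" "distinct c" "set c = C" "card R = card C"
  shows "abs_minor A R C =
    \<bar>Determinant.det (Matrix.mat (card C) (card C) (\<lambda>(i, j). A $ (r ! i) $ (c ! j)))\<bar>"
proof -
  let ?n = "card C"
  let ?D = "\<lambda>r c. \<bar>Determinant.det (Matrix.mat ?n ?n (\<lambda>(i, j). A $ (r ! i) $ (c ! j)))\<bar>"
  define r' where "r' = (SOME r. distinct r \<and> set r = R)"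
  define c' where "c' = (SOME c. distinct c \<and> set c = C)"
  have r': "distinct r' \<and> set r' = R"
    unfolding r'_def by (rule someI_ex) (use assms in blast)
  have c': "distinct c' \<and> set c' = C"
    unfolding c'_def by (rule someI_ex) (use assms in blast)
  have len: "length r = ?n" "length c = ?n" "length r' = ?n" "length c' = ?n"
    using assms r' c' distinct_card by metis+
  \<comment> \<open>Transposition reduces the reordering of columns to that of rows.\<close>
  have transp: "?D r c = \<bar>Determinant.det (Matrix.mat ?n ?n (\<lambda>(i, j). A $ (r ! j) $ (c ! i)))\<bar>" for r c
  proof -
    have "Matrix.mat ?n ?n (\<lambda>(i, j). A $ (r ! j) $ (c ! i)) =
        transpose_mat (Matrix.mat ?n ?n (\<lambda>(i, j). A $ (r ! i) $ (c ! j)))"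
      by (rule eq_matI) auto
    then show ?thesis
      by (simp add: Determinant.det_transpose[where n = ?n])
  qed
  have "?D r' c' = ?D r c'"
    using abs_det_reorder_rows[of r' r ?n "\<lambda>k j. A $ k $ (c' ! j)"] assms r' len by simp
  also have "\<dots> = ?D r c"
    unfolding transp
    using abs_det_reorder_rows[of c' c ?n "\<lambda>k j. A $ (r ! j) $ k"] assms c' len by simp
  finally show ?thesis
    by (simp add: abs_minor_def r'_def c'_def)
qed

lemma sum_nth_UNIV:
  fixes c :: "'d::finite list" and f :: "'d \<Rightarrow> real"
  assumes "distinct c" "set c = UNIV"
  shows "(\<Sum>k<CARD('d). f (c ! k)) = (\<Sum>j\<in>UNIV. f j)"
proof -
  have "length c = CARD('d)"
    using assms distinct_card by metis
  then show ?thesis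
    using sum.reindex_bij_betw[OF bij_betw_nth[of c "{..<CARD('d)}" UNIV], of f] assms by simp
qed

text \<open>Determinants are multiplicative as soon as the columns of \<open>U\<close> and the rows
  of \<open>T\<close> are enumerated by the same list.\<close>

lemma abs_minor_mult:
  fixes U :: "real^'d^'n" and T :: "real^'d^'d"
  assumes "card R = CARD('d)"
  shows "abs_minor (U ** T) R UNIV = abs_minor U R UNIV * abs_minor T UNIV UNIV"
proof -
  obtain r where r: "distinct r" "set r = R"
    using finite_distinct_list[of R] by auto
  obtain c :: "'d list" where c: "distinct c" "set c = UNIV"
    using finite_distinct_list[of "UNIV :: 'd set"] by auto
  let ?n = "CARD('d)"
  let ?U = "Matrix.mat ?n ?n (\<lambda>(i, j). U $ (r ! i) $ (c ! j))"
  let ?T = "Matrix.mat ?n ?n (\<lambda>(i, j). T $ (c ! i) $ (c ! j))"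
  have "Matrix.mat ?n ?n (\<lambda>(i, j). (U ** T) $ (r ! i) $ (c ! j)) = ?U * ?T"
    by (rule eq_matI)
       (auto simp: scalar_prod_def matrix_matrix_mult_def sum_nth_UNIV[OF c, symmetric] lessThan_atLeast0)
  then show ?thesis
    using r c assms
    by (simp add: abs_minor_eq[OF r c] abs_minor_eq[OF c c] abs_mult Determinant.det_mult[where n = ?n])
qed

lemma abs_minor_mat_1: "abs_minor (Finite_Cartesian_Product.mat 1 :: real^'d^'d) UNIV UNIV = 1"
proof -
  obtain c :: "'d list" where c: "distinct c" "set c = UNIV"
    using finite_distinct_list[of "UNIV :: 'd set"] by auto
  have len: "length c = CARD('d)"
    using c distinct_card by metis
  have "Matrix.mat CARD('d) CARD('d)
      (\<lambda>(i, j). (Finite_Cartesian_Product.mat 1 :: real^'d^'d) $ (c ! i) $ (c ! j)) = 1\<^sub>m CARD('d)"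
    by (rule eq_matI) (auto simp: Finite_Cartesian_Product.mat_def nth_eq_iff_index_eq[OF c(1)] len)
  then show ?thesis
    by (simp add: abs_minor_eq[OF c c])
qed

text \<open>This minor is the factor between a partial derivative and the corresponding star
  equation; since it is nonzero, both have the same zeros.\<close>

lemma abs_minor_invertible:
  fixes T :: "real^'d^'d"
  assumes "invertible T"
  shows "abs_minor T UNIV UNIV \<noteq> 0"
proof -
  obtain T' where "T ** T' = Finite_Cartesian_Product.mat 1"
    using assms by (auto simp: invertible_def)
  then have "abs_minor T UNIV UNIV * abs_minor T' UNIV UNIV = 1"
    using abs_minor_mult[of UNIV T T'] abs_minor_mat_1[where 'd = 'd] by simp
  then show ?thesis by auto
qed

text \<open>Listing the rows \<open>R0\<close> first and the columns \<open>K\<close> in the matching order turns the matrix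
  into block lower triangular form with an identity block.\<close>

lemma abs_minor_unit_rows:
  fixes A :: "real^'d^'n"
  assumes bij: "bij_betw (($) A) R0 ((\<lambda>j. axis j 1) ` K)"
    and R0: "R0 \<subseteq> R" and R: "card R = CARD('d)"
  shows "abs_minor A R UNIV = abs_minor A (R - R0) (- K)"
proof -
  have inj_axis: "inj_on (\<lambda>j. axis j 1 :: real^'d) K"
    by (auto simp: inj_on_def axis_eq_axis)
  have "bij_betw (\<lambda>j. axis j 1 :: real^'d) K ((\<lambda>j. axis j 1) ` K)"
    using inj_axis by (simp add: bij_betw_def)
  then have bij': "bij_betw (the_inv_into K (\<lambda>j. axis j 1) \<circ> ($) A) R0 K"
    using bij bij_betw_the_inv_into bij_betw_trans by blast
  \<comment> \<open>\<open>\<pi>\<close> reads off, from a row that is a unit vector, the column of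
    its entry 1. Listing \<open>K\<close> along \<open>\<pi>\<close> makes the upper left block
    exactly the identity.\<close>
  define \<pi> where "\<pi> = the_inv_into K (\<lambda>j. axis j 1) \<circ> ($) A"
  have \<pi>: "bij_betw \<pi> R0 K" using bij' by (simp add: \<pi>_def)
  have row: "A $ i = axis (\<pi> i) 1" if "i \<in> R0" for i
    using that bij f_the_inv_into_f[OF inj_axis, of "A $ i"] bij_betwE[OF bij] by (simp add: \<pi>_def)
  obtain r0 where r0: "distinct r0" "set r0 = R0"
    using finite_distinct_list[of R0] by auto
  obtain r1 where r1: "distinct r1" "set r1 = R - R0"
    using finite_distinct_list[of "R - R0"] by auto
  obtain c1 where c1: "distinct c1" "set c1 = - K"
    using finite_distinct_list[of "- K"] by auto
  define c0 where "c0 = map \<pi> r0"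
  have c0: "distinct c0" "set c0 = K"
    using r0 \<pi> by (auto simp: c0_def bij_betw_def distinct_map)
  let ?k = "length r0" let ?m = "card (- K)"
  have cardK: "card K = ?k"
    using bij_betw_same_card[OF \<pi>] distinct_card[OF r0(1)] r0 by simp
  have n: "CARD('d) = ?k + ?m"
    using card_Un_disjoint[of K "- K"] by (simp add: cardK)
  have cR: "card (R - R0) = ?m"
    using R R0 n cardK bij_betw_same_card[OF \<pi>] by (simp add: card_Diff_subset)
  have len: "length r1 = ?m" "length c1 = ?m" "length c0 = ?k"
    using distinct_card[OF r1(1)] distinct_card[OF c1(1)] r1 c1 cR by (auto simp: c0_def)
  have r: "distinct (r0 @ r1)" "set (r0 @ r1) = R"
    using r0 r1 R0 by auto
  have c: "distinct (c0 @ c1)" "set (c0 @ c1) = UNIV"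
    using c0 c1 by auto
  let ?L = "Matrix.mat ?m ?k (\<lambda>(i, j). A $ (r1 ! i) $ (c0 ! j))"
  let ?M = "Matrix.mat ?m ?m (\<lambda>(i, j). A $ (r1 ! i) $ (c1 ! j))"
  have r0in: "r0 ! i \<in> R0" if "i < ?k" for i
    using that r0 nth_mem by blast
  have c1in: "c1 ! j \<notin> K" if "j < ?m" for j
    using that c1 len nth_mem[of j c1] by auto
  have \<pi>K: "\<pi> i \<in> K" if "i \<in> R0" for i
    using that \<pi> by (auto simp: bij_betw_def)
  have \<pi>eq: "\<pi> (r0 ! i) = \<pi> (r0 ! j) \<longleftrightarrow> i = j" if "i < ?k" "j < ?k" for i j
    using that c0(1) nth_eq_iff_index_eq[of c0 i j] by (simp add: c0_def)
  have "Matrix.mat CARD('d) CARD('d) (\<lambda>(i, j). A $ ((r0 @ r1) ! i) $ ((c0 @ c1) ! j)) =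
        four_block_mat (1\<^sub>m ?k) (0\<^sub>m ?k ?m) ?L ?M"
  proof (rule eq_matI; goal_cases)
    case (1 i j)
    then have ij: "i < ?k + ?m" "j < ?k + ?m" by auto
    show ?case
    proof (cases "i < ?k")
      case True
      note ri = r0in[OF True]
      show ?thesis
      proof (cases "j < ?k")
        case True
        then have "c0 ! j = \<pi> (r0 ! j)" by (simp add: c0_def)
        then show ?thesis
          using ri True \<open>i < ?k\<close> \<pi>eq[OF True \<open>i < ?k\<close>]
          by (simp add: n nth_append len row axis_def)
      next
        case False
        with ij have "j - ?k < ?m" by linarith
        then have "c1 ! (j - ?k) \<noteq> \<pi> (r0 ! i)"
          using c1in \<pi>K[OF ri] by metis
        then show ?thesis
          using ri ij False \<open>i < ?k\<close> by (simp add: n nth_append len row axis_def)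
      qed
    next
      case False
      then show ?thesis
        using ij by (auto simp: n nth_append len)
    qed
  qed (simp_all add: n)
  moreover have "Determinant.det (four_block_mat (1\<^sub>m ?k) (0\<^sub>m ?k ?m) ?L ?M) = Determinant.det ?M"
    by (subst det_four_block_mat_upper_right_zero[where n = ?k and m = ?m]) auto
  ultimately show ?thesis
    using abs_minor_eq[OF r c] abs_minor_eq[OF r1 c1] R cR by simp
qed

section \<open>Simplicial cones\<close>

text \<open>Independence is stated for vectors indexed by labels, so that coefficients are functions
  of labels. On a finite index set it also excludes repeated vectors, which independence of the
  image set would not.\<close>

definition indep_family :: "('i \<Rightarrow> 'a::real_vector) \<Rightarrow> 'i set \<Rightarrow> bool" where
  "indep_family f I \<longleftrightarrow> (\<forall>c. (\<Sum>i\<in>I. c i *\<^sub>R f i) = 0 \<longrightarrow> (\<forall>i\<in>I. c i = 0))"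

lemma indep_familyD:
  "indep_family f I \<Longrightarrow> (\<Sum>i\<in>I. c i *\<^sub>R f i) = 0 \<Longrightarrow> i \<in> I \<Longrightarrow> c i = 0"
  by (auto simp: indep_family_def)

lemma indep_family_eqD:
  assumes "indep_family f I" "(\<Sum>i\<in>I. c i *\<^sub>R f i) = (\<Sum>i\<in>I. d i *\<^sub>R f i)" "i \<in> I"
  shows "c i = d i"
proof -
  have "(\<Sum>i\<in>I. (c i - d i) *\<^sub>R f i) = 0"
    using assms(2) by (simp add: scaleR_diff_left sum_subtractf)
  then have "c i - d i = 0"
    by (rule indep_familyD[OF assms(1) _ assms(3), of "\<lambda>i. c i - d i"])
  then show ?thesis by simp
qed

lemma sum_scaleR_extend:
  fixes f :: "'i \<Rightarrow> 'a::real_vector"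
  assumes "finite I" "C \<subseteq> I"
  shows "(\<Sum>i\<in>C. c i *\<^sub>R f i) = (\<Sum>i\<in>I. (if i \<in> C then c i else 0) *\<^sub>R f i)"
proof -
  have "(\<Sum>i\<in>I. (if i \<in> C then c i else 0) *\<^sub>R f i) = (\<Sum>i\<in>C. (if i \<in> C then c i else 0) *\<^sub>R f i)"
    by (rule sum.mono_neutral_right) (use assms in auto)
  then show ?thesis by simp
qed

lemma indep_family_subset:
  assumes "indep_family f I" "C \<subseteq> I" "finite I"
  shows "indep_family f C"
  unfolding indep_family_def
proof (intro allI impI ballI)
  fix c i assume *: "(\<Sum>i\<in>C. c i *\<^sub>R f i) = 0" "i \<in> C"
  then have "(if i \<in> C then c i else 0) = 0"
    using indep_familyD[OF assms(1), of "\<lambda>i. if i \<in> C then c i else 0" i] assms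
    by (auto simp: sum_scaleR_extend[OF assms(3,2)])
  with * show "c i = 0" by simp
qed

lemma independent_indep_family:
  fixes B :: "'a::real_vector set"
  assumes "independent B" "finite B"
  shows "indep_family (\<lambda>b. b) B"
  using assms by (auto simp: indep_family_def dependent_finite)

lemma indep_family_inj_on:
  assumes "indep_family f I" "finite I"
  shows "inj_on f I"
proof (rule inj_onI, rule ccontr)
  fix i j assume ij: "i \<in> I" "j \<in> I" "f i = f j" "i \<noteq> j"
  have "(\<Sum>k\<in>{i, j}. (if k = i then 1 else - 1) *\<^sub>R f k) = 0"
    using ij by simp
  from indep_familyD[OF indep_family_subset[OF assms(1), of "{i, j}"] this, of i] ij assms(2)
  show False by simp
qed

lemma indep_family_independent:
  fixes f :: "'i \<Rightarrow> 'a::real_vector"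
  assumes "indep_family f I" "finite I"
  shows "independent (f ` I)"
proof -
  have "\<forall>v\<in>f ` I. u v = 0" if "(\<Sum>v\<in>f ` I. u v *\<^sub>R v) = 0" for u
    using that indep_familyD[OF assms(1), of "u \<circ> f"]
    by (auto simp: sum.reindex[OF indep_family_inj_on[OF assms]])
  then show ?thesis
    using assms(2) by (auto simp: dependent_finite)
qed

section \<open>Finitely generated cones and their faces\<close>

lemma convex_cone_sum:
  assumes "convex_cone S" "\<And>i. i \<in> I \<Longrightarrow> g i \<in> S"
  shows "sum g I \<in> S"
  using assms(2)
  by (induction I rule: infinite_finite_induct)
     (auto intro: convex_cone_contains_0 convex_cone_add assms(1))

text \<open>The right-hand side is itself a convex cone containing the generators. A
  \<open>convex_cone\<close> contains 0, so the empty family generates \<open>{0}\<close>, in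
  agreement with the empty sum.\<close>

lemma convex_cone_hull_explicit:
  fixes f :: "'i \<Rightarrow> 'a::real_vector"
  assumes "finite I"
  shows "convex_cone hull (f ` I) = {\<Sum>i\<in>I. c i *\<^sub>R f i | c. \<forall>i\<in>I. 0 \<le> c i}" (is "_ = ?R")
proof
  have "f i \<in> ?R" if "i \<in> I" for i
  proof -
    have "f i = (\<Sum>j\<in>I. (if j = i then 1 else 0) *\<^sub>R f j)"
      using that assms by (simp add: if_distrib[of "\<lambda>c. c *\<^sub>R _"] cong: if_cong)
    then show ?thesis
      by (intro CollectI exI[of _ "\<lambda>j. if j = i then 1 else 0"]) auto
  qed
  moreover have "convex_cone ?R"
    unfolding convex_cone_iff
  proof (intro conjI ballI allI impI)
    show "0 \<in> ?R"
      by (intro CollectI exI[of _ "\<lambda>_. 0"]) auto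
    fix x assume "x \<in> ?R"
    then obtain c where c: "x = (\<Sum>i\<in>I. c i *\<^sub>R f i)" "\<forall>i\<in>I. 0 \<le> c i" by auto
    show "t *\<^sub>R x \<in> ?R" if "t \<ge> 0" for t
      using c that by (intro CollectI exI[of _ "\<lambda>i. t * c i"]) (auto simp: scaleR_sum_right)
    fix y assume "y \<in> ?R"
    then obtain d where "y = (\<Sum>i\<in>I. d i *\<^sub>R f i)" "\<forall>i\<in>I. 0 \<le> d i" by auto
    with c show "x + y \<in> ?R"
      by (intro CollectI exI[of _ "\<lambda>i. c i + d i"]) (auto simp: scaleR_add_left sum.distrib)
  qed
  ultimately show "convex_cone hull (f ` I) \<subseteq> ?R"
    by (intro hull_minimal) auto
  show "?R \<subseteq> convex_cone hull (f ` I)"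
    by (auto intro!: convex_cone_sum[OF convex_cone_convex_cone_hull] convex_cone_hull_mul intro: hull_inc)
qed

text \<open>Coefficients with respect to an independent family are unique, so those of
  \<open>f i\<close> must be supported at \<open>i\<close>.\<close>

lemma in_convex_cone_hull_iff:
  assumes "indep_family f I" "finite I" "C \<subseteq> I" "i \<in> I"
  shows "f i \<in> convex_cone hull (f ` C) \<longleftrightarrow> i \<in> C"
proof
  assume "f i \<in> convex_cone hull (f ` C)"
  then obtain c where "f i = (\<Sum>i\<in>C. c i *\<^sub>R f i)"
    using finite_subset[OF assms(3,2)] by (auto simp: convex_cone_hull_explicit)
  then have eq: "(\<Sum>j\<in>I. (if j = i then 1 else 0) *\<^sub>R f j) = (\<Sum>j\<in>I. (if j \<in> C then c j else 0) *\<^sub>R f j)"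
    using assms(4,2) unfolding sum_scaleR_extend[OF assms(2,3)]
    by (simp add: if_distrib[of "\<lambda>c. c *\<^sub>R _"] cong: if_cong)
  show "i \<in> C"
    using indep_family_eqD[OF assms(1) eq assms(4)] by (auto split: if_splits)
qed (auto intro: hull_inc)

text \<open>At a point strictly between \<open>a\<close> and \<open>b\<close>, each coefficient is a
  sum of nonnegative multiples of the two end coefficients with positive weights. If it vanishes for
  an index outside \<open>C\<close>, both end coefficients vanish as well.\<close>

lemma subcone_face_of:
  fixes f :: "'i \<Rightarrow> 'a::real_vector"
  assumes "indep_family f I" "finite I" "C \<subseteq> I"
  shows "convex_cone hull (f ` C) face_of convex_cone hull (f ` I)"
  unfolding face_of_def
proof (intro conjI ballI impI)
  show "convex_cone hull (f ` C) \<subseteq> convex_cone hull (f ` I)"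
    using assms(3) by (intro hull_mono) auto
  show "convex (convex_cone hull (f ` C))"
    by (rule convex_convex_cone_hull)
  have finC: "finite C" using assms finite_subset by blast
  fix a b x
  assume ab: "a \<in> convex_cone hull (f ` I)" "b \<in> convex_cone hull (f ` I)"
    and x: "x \<in> convex_cone hull (f ` C)" "x \<in> open_segment a b"
  from ab obtain p q where p: "a = (\<Sum>i\<in>I. p i *\<^sub>R f i)" "\<forall>i\<in>I. 0 \<le> p i"
    and q: "b = (\<Sum>i\<in>I. q i *\<^sub>R f i)" "\<forall>i\<in>I. 0 \<le> q i"
    using assms(2) by (auto simp: convex_cone_hull_explicit)
  from x obtain c where c: "x = (\<Sum>i\<in>C. c i *\<^sub>R f i)"
    using finC by (auto simp: convex_cone_hull_explicit)
  from x obtain u where u: "0 < u" "u < 1" "x = (1 - u) *\<^sub>R a + u *\<^sub>R b"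
    by (auto simp: in_segment)
  have eq: "(\<Sum>i\<in>I. (if i \<in> C then c i else 0) *\<^sub>R f i) = (\<Sum>i\<in>I. ((1 - u) * p i + u * q i) *\<^sub>R f i)"
    using c u(3) p q
    by (simp add: sum_scaleR_extend[OF assms(2,3)] scaleR_sum_right scaleR_add_left sum.distrib)
  have z: "p i = 0 \<and> q i = 0" if "i \<in> I" "i \<notin> C" for i
  proof -
    have "(1 - u) * p i + u * q i = 0"
      using indep_family_eqD[OF assms(1) eq that(1)] that by simp
    moreover have "(1 - u) * p i \<ge> 0" "u * q i \<ge> 0"
      using p(2) q(2) u that by auto
    ultimately show ?thesis using u
      by (metis add_nonneg_eq_0_iff diff_gt_0_iff_gt less_irrefl mult_eq_0_iff)
  qed
  have sub: "(\<Sum>i\<in>I. r i *\<^sub>R f i) \<in> convex_cone hull (f ` C)"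
    if "\<forall>i\<in>I. 0 \<le> r i" "\<And>i. i \<in> I \<Longrightarrow> i \<notin> C \<Longrightarrow> r i = 0" for r
  proof -
    have "(\<Sum>i\<in>I. r i *\<^sub>R f i) = (\<Sum>i\<in>C. r i *\<^sub>R f i)"
      by (rule sum.mono_neutral_right) (use assms that in auto)
    then show ?thesis
      using that assms(3) finC by (auto simp: convex_cone_hull_explicit)
  qed
  show "a \<in> convex_cone hull (f ` C)" "b \<in> convex_cone hull (f ` C)"
    using p q z by (auto intro!: sub)
qed

text \<open>Once a sum of cone elements lies in a face, so do the summands. Hence every generator
  that occurs with nonzero coefficient in an element of the face belongs to the face.\<close>

lemma face_of_convex_cone_hull:
  fixes f :: "'i \<Rightarrow> 'a::real_vector"
  assumes F: "F face_of convex_cone hull (f ` I)" "F \<noteq> {}" and "finite I"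
  shows "F = convex_cone hull (f ` {i \<in> I. f i \<in> F})"
proof -
  let ?S = "convex_cone hull (f ` I)"
  have FS: "F \<subseteq> ?S" using F face_of_imp_subset by blast
  have conv: "convex F" using F face_of_imp_convex by blast
  \<comment> \<open>Faces are defined through open segments, and \<open>x + y\<close> is the
    midpoint of \<open>2 *\<^sub>R x\<close> and \<open>2 *\<^sub>R y\<close>. For
    \<open>x = y\<close> this segment degenerates, and the one from 0 to
    \<open>4 *\<^sub>R x\<close> takes its place.\<close>
  have split: "x \<in> F \<and> y \<in> F" if "x \<in> ?S" "y \<in> ?S" "x + y \<in> F" for x y
  proof (cases "x = y")
    case True
    have S: "4 *\<^sub>R x \<in> ?S" "(0::'a) \<in> ?S"
      using that by (auto intro: convex_cone_hull_mul convex_cone_hull_contains_0)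
    show ?thesis
    proof (cases "x = 0")
      case True
      then show ?thesis using that \<open>x = y\<close> by simp
    next
      case False
      then have "x + y \<in> open_segment 0 (4 *\<^sub>R x)"
        using True by (auto simp: in_segment intro!: exI[of _ "1/2"] simp flip: scaleR_2)
      from face_ofD[OF F(1) this] S that have *: "0 \<in> F" "4 *\<^sub>R x \<in> F" by auto
      have "(3/4) *\<^sub>R 0 + (1/4) *\<^sub>R (4 *\<^sub>R x) \<in> F"
        using conv * by (intro convexD) auto
      then show ?thesis using True by simp
    qed
  next
    case False
    have S: "2 *\<^sub>R x \<in> ?S" "2 *\<^sub>R y \<in> ?S" "(0::'a) \<in> ?S"
      using that by (auto intro: convex_cone_hull_mul convex_cone_hull_contains_0)
    have "x + y \<in> open_segment (2 *\<^sub>R x) (2 *\<^sub>R y)"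
      using False by (auto simp: in_segment intro!: exI[of _ "1/2"])
    from face_ofD[OF F(1) this] S that have *: "2 *\<^sub>R x \<in> F" "2 *\<^sub>R y \<in> F" by auto
    have half: "v \<in> F" if v: "2 *\<^sub>R v \<in> F" "0 \<in> F" for v
      using convexD[OF conv v, of "1/2" "1/2"] by simp
    have "0 \<in> F"
    proof (cases "x + y = 0")
      case True
      then show ?thesis using that by simp
    next
      case False
      have "x + y \<in> open_segment 0 (2 *\<^sub>R (x + y))"
        using False by (auto simp: in_segment intro!: exI[of _ "1/2"])
      from face_ofD[OF F(1) this S(3)] that show ?thesis
        by (meson convex_cone_hull_add convex_cone_hull_mul zero_le_numeral)
    qed
    then show ?thesis using half * by blast
  qed
  have "0 \<in> F"
  proof -
    obtain x where "x \<in> F" using F by auto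
    then show ?thesis
      using split[of 0 x] FS by (auto intro: convex_cone_hull_contains_0)
  qed
  \<comment> \<open>Shrinking stays in the face by convexity with 0. For \<open>t > 1\<close>, a
    nonzero \<open>x\<close> lies strictly between 0 and \<open>t *\<^sub>R x\<close>, so the face
    property applies.\<close>
  have big: "t *\<^sub>R x \<in> F" if "x \<in> F" "t \<ge> 0" for t x
  proof (cases "t \<le> 1")
    case True
    then show ?thesis
      using convexD[OF conv \<open>0 \<in> F\<close> that(1), of "1 - t" t] that by simp
  next
    case False
    have xS: "x \<in> ?S" using that FS by auto
    have "x = 0 \<or> x \<in> open_segment 0 (t *\<^sub>R x)"
      using False by (auto simp: in_segment intro!: exI[of _ "1 / t"])
    then show ?thesis
      using face_ofD[OF F(1), of x 0 "t *\<^sub>R x"] that xS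
      by (metis convex_cone_hull_contains_0 convex_cone_hull_mul scaleR_zero_right)
  qed
  have cone: "convex_cone F"
    using conv big F(2) by (auto simp: convex_cone_def conic_def)
  show ?thesis
  proof
    show "convex_cone hull (f ` {i \<in> I. f i \<in> F}) \<subseteq> F"
      by (rule hull_minimal) (use cone in auto)
    show "F \<subseteq> convex_cone hull (f ` {i \<in> I. f i \<in> F})"
    proof
      fix x assume "x \<in> F"
      then obtain c where c: "x = (\<Sum>i\<in>I. c i *\<^sub>R f i)" "\<forall>i\<in>I. 0 \<le> c i"
        using FS \<open>finite I\<close> by (auto simp: convex_cone_hull_explicit)
      have mem: "c i *\<^sub>R f i \<in> ?S" if "i \<in> I" for i
        using that c(2) by (auto intro!: convex_cone_hull_mul intro: hull_inc)
      have gen: "f i \<in> F" if i: "i \<in> I" "c i \<noteq> 0" for i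
      proof -
        have "x = c i *\<^sub>R f i + (\<Sum>j\<in>I - {i}. c j *\<^sub>R f j)"
          using \<open>finite I\<close> i by (simp add: c(1) sum.remove)
        moreover have "(\<Sum>j\<in>I - {i}. c j *\<^sub>R f j) \<in> ?S"
          using mem by (auto intro!: convex_cone_sum convex_cone_convex_cone_hull)
        ultimately have "c i *\<^sub>R f i \<in> F"
          using split mem i \<open>x \<in> F\<close> by blast
        moreover have "1 / c i \<ge> 0"
          using c(2) i by simp
        ultimately have "(1 / c i) *\<^sub>R (c i *\<^sub>R f i) \<in> F"
          by (rule big)
        then show ?thesis using i by simp
      qed
      have "c i *\<^sub>R f i \<in> convex_cone hull (f ` {i \<in> I. f i \<in> F})" if "i \<in> I" for i
      proof (cases "c i = 0")
        case True
        then show ?thesis by (simp add: convex_cone_hull_contains_0)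
      next
        case False
        then show ?thesis
          using gen[OF that] that c(2) by (auto intro!: convex_cone_hull_mul intro: hull_inc)
      qed
      then show "x \<in> convex_cone hull (f ` {i \<in> I. f i \<in> F})"
        unfolding c(1) by (intro convex_cone_sum convex_cone_convex_cone_hull)
    qed
  qed
qed

lemma span_convex_cone_hull: "span (convex_cone hull S) = span S"
proof -
  have "convex_cone (span S)"
    by (auto simp: convex_cone_iff span_zero span_add span_scale)
  then have "convex_cone hull S \<subseteq> span S"
    by (intro hull_minimal span_superset)
  then show ?thesis
    by (meson hull_subset span_minimal span_mono subspace_span subset_antisym)
qed

lemma dim_convex_cone_hull:
  fixes f :: "'i \<Rightarrow> 'a::euclidean_space"
  assumes "indep_family f I" "finite I"
  shows "dim (convex_cone hull (f ` I)) = card I"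
proof -
  have "dim (convex_cone hull (f ` I)) = dim (f ` I)"
    by (metis dim_span span_convex_cone_hull)
  also have "\<dots> = card (f ` I)"
    by (rule dim_eq_card_independent[OF indep_family_independent[OF assms]])
  finally show ?thesis
    by (simp add: card_image indep_family_inj_on[OF assms])
qed

lemma in_convex_cone_hull_singleton:
  "x \<in> convex_cone hull {v} \<longleftrightarrow> (\<exists>c\<ge>0. x = c *\<^sub>R v)"
  using convex_cone_hull_explicit[of "{()}" "\<lambda>_. v"] by auto

lemma convex_cone_hull_singleton_eqI:
  assumes "x \<in> convex_cone hull {v}" "x \<noteq> 0"
  shows "convex_cone hull {x} = convex_cone hull {v}"
proof -
  obtain c where c: "c \<ge> 0" "x = c *\<^sub>R v"
    using assms by (auto simp: in_convex_cone_hull_singleton)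
  then have "v = (1 / c) *\<^sub>R x" "0 \<le> 1 / c"
    using assms by auto
  then have "v \<in> convex_cone hull {x}"
    unfolding in_convex_cone_hull_singleton by blast
  then show ?thesis
    using assms by (intro subset_antisym hull_minimal convex_cone_convex_cone_hull) auto
qed

section \<open>Simplicial fans\<close>

locale simplicial_fan_rays =
  fixes \<Sigma> :: "(real^'d) set set" and U :: "real^'d^'n"
  assumes simplicial: "simplicial_fan \<Sigma>" and ray_matrix: "ray_matrix \<Sigma> U"
begin

abbreviation labels :: "(real^'d) set \<Rightarrow> 'n set" where
  "labels \<equiv> ray_labels U UNIV"

lemma row_nonzero: "U $ i \<noteq> 0"
  using ray_matrix by (simp add: ray_matrix_def)

lemma ray_inject: "ray U i = ray U j \<longleftrightarrow> i = j"
  using ray_matrix by (auto simp: ray_matrix_def bij_betw_def inj_on_def)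

lemma row_in_ray: "U $ i \<in> ray U i"
  by (simp add: ray_def hull_inc)

lemma ray_in_fan: "ray U i \<in> \<Sigma>"
  using ray_matrix by (auto simp: ray_matrix_def bij_betw_def fan_cones_def)

lemma dim1_cone_is_ray:
  assumes "\<sigma> \<in> \<Sigma>" "dim \<sigma> = 1"
  obtains i where "\<sigma> = ray U i"
proof -
  have "\<sigma> \<in> range (ray U)"
    using assms ray_matrix by (simp add: ray_matrix_def bij_betw_def fan_cones_def)
  then show ?thesis using that by auto
qed

lemma finite_fan: "finite \<Sigma>"
  using simplicial by (simp add: simplicial_fan_def polyhedral_fan_def)

lemma face_in_fan: "\<sigma> \<in> \<Sigma> \<Longrightarrow> \<tau> face_of \<sigma> \<Longrightarrow> \<tau> \<noteq> {} \<Longrightarrow> \<tau> \<in> \<Sigma>"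
  using simplicial unfolding simplicial_fan_def polyhedral_fan_def by blast

lemma Int_face_of:
  assumes "\<sigma> \<in> \<Sigma>" "\<tau> \<in> \<Sigma>"
  shows "(\<sigma> \<inter> \<tau>) face_of \<sigma>" "(\<sigma> \<inter> \<tau>) face_of \<tau>"
  using assms simplicial by (simp_all add: simplicial_fan_def polyhedral_fan_def)

text \<open>The basis \<open>B\<close> given by simpliciality is arbitrary. Each of its vectors
  generates a one-dimensional face, hence a ray of the fan, and is therefore a positive multiple of
  some row of \<open>U\<close>. This matches \<open>B\<close> with the labels of the cone, so that
  the rows of \<open>U\<close> can replace \<open>B\<close> from here on.\<close>

lemma cone_representation:
  assumes "\<sigma> \<in> \<Sigma>"
  shows "indep_family (($) U) (labels \<sigma>) \<and> cone_over U (labels \<sigma>) = \<sigma>"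
proof -
  obtain B where B: "independent B" "\<sigma> = convex_cone hull B"
    using simplicial assms by (auto simp: simplicial_fan_def)
  then have finB: "finite B" using independent_imp_finite by blast
  have ind: "indep_family (\<lambda>b. b) B"
    using independent_indep_family B finB by blast
  have sub: "convex_cone hull {b} face_of \<sigma>" if "b \<in> B" for b
    using subcone_face_of[OF ind finB, of "{b}"] that B by simp
  have "\<exists>i c. c > 0 \<and> U $ i = c *\<^sub>R b \<and> ray U i = convex_cone hull {b}" if b: "b \<in> B" for b
  proof -
    have "dim (convex_cone hull {b}) = 1"
      using dim_convex_cone_hull[OF indep_family_subset[OF ind, of "{b}"]] b finB by simp
    then obtain i where i: "convex_cone hull {b} = ray U i"
      using dim1_cone_is_ray[OF face_in_fan[OF assms sub[OF b] convex_cone_hull_nonempty]] by metis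
    then obtain c where "c \<ge> 0" "U $ i = c *\<^sub>R b"
      using row_in_ray[of i] by (metis in_convex_cone_hull_singleton)
    moreover from this have "c \<noteq> 0" using row_nonzero[of i] by auto
    ultimately show ?thesis using i by (metis less_le)
  qed
  \<comment> \<open>\<open>g b\<close> is the label of the ray through \<open>b\<close>, and
    \<open>c b\<close> the factor that rescales \<open>b\<close> to the chosen row.\<close>
  then obtain g c where gc: "\<And>b. b \<in> B \<Longrightarrow> c b > 0" "\<And>b. b \<in> B \<Longrightarrow> U $ g b = c b *\<^sub>R b"
    "\<And>b. b \<in> B \<Longrightarrow> ray U (g b) = convex_cone hull {b}"
    by metis
  have lab: "labels \<sigma> = g ` B"
  proof
    show "g ` B \<subseteq> labels \<sigma>"
      using sub gc by (auto simp: ray_labels_def)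
    \<comment> \<open>A ray that is a face is generated by the elements of \<open>B\<close> in it.
      There is at least one such element, because the ray is not \<open>{0}\<close>, and it
      generates the whole ray.\<close>
    show "labels \<sigma> \<subseteq> g ` B"
    proof
      fix i assume "i \<in> labels \<sigma>"
      then have "ray U i face_of convex_cone hull ((\<lambda>b. b) ` B)"
        using B by (simp add: ray_labels_def)
      from face_of_convex_cone_hull[OF this _ finB] row_in_ray[of i]
      have "ray U i = convex_cone hull {b \<in> B. b \<in> ray U i}" by auto
      moreover have "ray U i \<noteq> {0}"
        using row_in_ray[of i] row_nonzero[of i] by auto
      ultimately obtain b where b: "b \<in> B" "b \<in> ray U i"
        by (metis (mono_tags, lifting) Collect_empty_eq convex_cone_hull_empty)
      moreover have "b \<noteq> 0"
        using b B dependent_zero by blast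
      ultimately have "convex_cone hull {b} = ray U i"
        unfolding ray_def by (rule_tac convex_cone_hull_singleton_eqI)
      then show "i \<in> g ` B"
        using gc(3)[OF b(1)] b(1) ray_inject by auto
    qed
  qed
  have inj: "inj_on g B"
  proof (rule inj_onI)
    fix a b assume ab: "a \<in> B" "b \<in> B" "g a = g b"
    then have "a \<in> convex_cone hull ((\<lambda>b. b) ` {b})"
      using gc(3) by (metis hull_inc image_ident singletonI)
    then show "a = b"
      using in_convex_cone_hull_iff[OF ind finB, of "{b}" a] ab by simp
  qed
  have "indep_family (($) U) (labels \<sigma>)"
    unfolding indep_family_def lab
  proof (intro allI impI)
    fix d assume "(\<Sum>i\<in>g ` B. d i *\<^sub>R U $ i) = 0"
    then have "(\<Sum>b\<in>B. (d (g b) * c b) *\<^sub>R b) = 0"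
      using gc by (simp add: sum.reindex[OF inj])
    from indep_familyD[OF ind this] gc(1) show "\<forall>i\<in>g ` B. d i = 0" by fastforce
  qed
  moreover have "cone_over U (labels \<sigma>) = \<sigma>"
  proof
    show "cone_over U (labels \<sigma>) \<subseteq> \<sigma>"
      unfolding cone_over_def lab unfolding B(2)
      by (intro hull_minimal convex_cone_convex_cone_hull)
         (auto simp: gc(1,2) less_imp_le intro!: convex_cone_hull_mul intro: hull_inc)
    have "b \<in> cone_over U (labels \<sigma>)" if "b \<in> B" for b
    proof -
      have "b \<in> convex_cone hull {U $ g b}"
        using gc(3)[OF that] by (metis hull_inc insertI1 ray_def)
      moreover have "convex_cone hull {U $ g b} \<subseteq> cone_over U (labels \<sigma>)"
        unfolding cone_over_def lab using that by (intro hull_mono) auto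
      ultimately show ?thesis by auto
    qed
    then show "\<sigma> \<subseteq> cone_over U (labels \<sigma>)"
      unfolding B(2) by (intro hull_minimal) (auto simp: cone_over_def convex_cone_convex_cone_hull)
  qed
  ultimately show ?thesis by blast
qed

lemmas indep_labels = cone_representation[THEN conjunct1]
lemmas cone_over_labels = cone_representation[THEN conjunct2]

lemma cone_eq_hull: "\<sigma> \<in> \<Sigma> \<Longrightarrow> \<sigma> = convex_cone hull (($) U ` labels \<sigma>)"
  using cone_over_labels by (simp add: cone_over_def)

lemma labels_inject: "\<sigma> \<in> \<Sigma> \<Longrightarrow> \<tau> \<in> \<Sigma> \<Longrightarrow> labels \<sigma> = labels \<tau> \<longleftrightarrow> \<sigma> = \<tau>"
  using cone_over_labels by metis

lemma dim_cone: "\<sigma> \<in> \<Sigma> \<Longrightarrow> dim \<sigma> = card (labels \<sigma>)"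
  using dim_convex_cone_hull[OF indep_labels] cone_eq_hull by (metis finite)

text \<open>A ray contained in \<sigma> is its own intersection with \<sigma>. As rays are cones of
  the fan, the fan axiom on intersections makes it a face.\<close>

lemma labels_alt:
  assumes \<sigma>: "\<sigma> \<in> \<Sigma>"
  shows "labels \<sigma> = {i. U $ i \<in> \<sigma>}"
proof (intro equalityI subsetI)
  fix i
  show "i \<in> {i. U $ i \<in> \<sigma>}" if "i \<in> labels \<sigma>"
    using that row_in_ray[of i] face_of_imp_subset by (auto simp: ray_labels_def)
  assume "i \<in> {i. U $ i \<in> \<sigma>}"
  then have "ray U i \<subseteq> \<sigma>"
    unfolding ray_def using \<sigma> cone_eq_hull[OF \<sigma>]
    by (metis convex_cone_convex_cone_hull hull_minimal empty_subsetI insert_subset mem_Collect_eq)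
  then have "ray U i face_of \<sigma>"
    using Int_face_of(1)[OF \<sigma> ray_in_fan[of i]] by (simp add: Int_absorb1)
  then show "i \<in> labels \<sigma>" by (simp add: ray_labels_def)
qed

lemma labels_mono_iff:
  assumes "\<sigma> \<in> \<Sigma>" "\<tau> \<in> \<Sigma>"
  shows "labels \<tau> \<subseteq> labels \<sigma> \<longleftrightarrow> \<tau> \<subseteq> \<sigma>"
proof
  assume "labels \<tau> \<subseteq> labels \<sigma>"
  then have "cone_over U (labels \<tau>) \<subseteq> cone_over U (labels \<sigma>)"
    unfolding cone_over_def by (intro hull_mono image_mono)
  then show "\<tau> \<subseteq> \<sigma>" by (simp add: assms cone_over_labels)
qed (use assms in \<open>auto simp: labels_alt\<close>)

lemma face_of_iff_labels:
  assumes "\<sigma> \<in> \<Sigma>" "\<tau> \<in> \<Sigma>"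
  shows "\<tau> face_of \<sigma> \<longleftrightarrow> labels \<tau> \<subseteq> labels \<sigma>"
  using Int_face_of(1)[OF assms] labels_mono_iff[OF assms] face_of_imp_subset
  by (metis Int_absorb1)

text \<open>By independence, any subset of the labels of a cone spans a face of it. Thus the label
  sets form a simplicial complex, and later arguments can work with sets of labels alone.\<close>

lemma subset_labels:
  assumes "\<sigma> \<in> \<Sigma>" "I \<subseteq> labels \<sigma>"
  shows "cone_over U I \<in> \<Sigma>" "labels (cone_over U I) = I"
proof -
  have "cone_over U I face_of \<sigma>"
    using subcone_face_of[OF indep_labels[OF assms(1)] _ assms(2)] cone_eq_hull[OF assms(1)]
    by (simp add: cone_over_def)
  then show in_fan: "cone_over U I \<in> \<Sigma>"
    by (rule face_in_fan[OF assms(1)]) (simp add: cone_over_def convex_cone_hull_nonempty)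
  have "i \<in> I" if "U $ i \<in> cone_over U I" for i
  proof -
    have "i \<in> labels \<sigma>"
      using that assms in_fan \<open>cone_over U I face_of \<sigma>\<close> face_of_imp_subset labels_alt by blast
    then show ?thesis
      using that in_convex_cone_hull_iff[OF indep_labels[OF assms(1)] _ assms(2)]
      by (simp add: cone_over_def)
  qed
  then show "labels (cone_over U I) = I"
    unfolding labels_alt[OF in_fan] by (auto simp: cone_over_def intro: hull_inc)
qed

text \<open>The intersection is a common face, hence a cone of the fan, and its labels are the
  common ones.\<close>

lemma Int_subset_cone_over:
  assumes "\<sigma> \<in> \<Sigma>" "\<tau> \<in> \<Sigma>"
  shows "\<sigma> \<inter> \<tau> \<subseteq> cone_over U (labels \<sigma> \<inter> labels \<tau>)"
proof -
  have "0 \<in> \<sigma> \<inter> \<tau>"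
    using assms cone_eq_hull convex_cone_hull_contains_0 by (metis IntI)
  then have "\<sigma> \<inter> \<tau> \<in> \<Sigma>"
    using Int_face_of(1)[OF assms] face_in_fan assms(1) by blast
  then have "cone_over U (labels (\<sigma> \<inter> \<tau>)) = \<sigma> \<inter> \<tau>" "labels (\<sigma> \<inter> \<tau>) = labels \<sigma> \<inter> labels \<tau>"
    using assms by (rule_tac cone_over_labels, auto simp: labels_alt)
  then show ?thesis by simp
qed

text \<open>Removes dimensions from the definition. The dimension count excludes the labels of
  \<tau> themselves; conversely, inside any cone containing \<tau> and the ray, the two span a face
  of dimension one more than \<tau>.\<close>

lemma nb_iff:
  assumes "\<tau> \<in> \<Sigma>"
  shows "i \<in> nb \<Sigma> U \<tau> \<longleftrightarrow> i \<notin> labels \<tau> \<and> (\<exists>\<sigma>\<in>\<Sigma>. insert i (labels \<tau>) \<subseteq> labels \<sigma>)"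
proof
  assume "i \<in> nb \<Sigma> U \<tau>"
  then obtain \<sigma> where \<sigma>: "\<sigma> \<in> \<Sigma>" "dim \<sigma> = dim \<tau> + 1" "insert i (labels \<tau>) = labels \<sigma>"
    by (auto simp: nb_def fan_cones_def)
  then have "card (labels \<sigma>) = card (labels \<tau>) + 1"
    using assms by (simp add: dim_cone)
  then have "i \<notin> labels \<tau>"
    using \<sigma>(3) by (metis Suc_eq_plus1 insert_absorb n_not_Suc_n)
  then show "i \<notin> labels \<tau> \<and> (\<exists>\<sigma>\<in>\<Sigma>. insert i (labels \<tau>) \<subseteq> labels \<sigma>)"
    using \<sigma> by auto
next
  assume *: "i \<notin> labels \<tau> \<and> (\<exists>\<sigma>\<in>\<Sigma>. insert i (labels \<tau>) \<subseteq> labels \<sigma>)"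
  then obtain \<sigma> where \<sigma>: "\<sigma> \<in> \<Sigma>" "insert i (labels \<tau>) \<subseteq> labels \<sigma>" by auto
  let ?\<sigma> = "cone_over U (insert i (labels \<tau>))"
  note s = subset_labels[OF \<sigma>]
  have "dim ?\<sigma> = dim \<tau> + 1"
    using * by (simp add: dim_cone[OF s(1)] s(2) dim_cone[OF assms])
  then show "i \<in> nb \<Sigma> U \<tau>"
    using s by (auto simp: nb_def fan_cones_def intro!: bexI[of _ ?\<sigma>])
qed

lemma nb_disjoint: "\<tau> \<in> \<Sigma> \<Longrightarrow> nb \<Sigma> U \<tau> \<inter> labels \<tau> = {}"
  by (auto simp: nb_iff)

lemma labels_diff_subset_nb:
  "\<tau> \<in> \<Sigma> \<Longrightarrow> \<sigma> \<in> \<Sigma> \<Longrightarrow> labels \<tau> \<subseteq> labels \<sigma> \<Longrightarrow> labels \<sigma> - labels \<tau> \<subseteq> nb \<Sigma> U \<tau>"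
  by (auto simp: nb_iff)

section \<open>Primitive collections and the cones of their proper subsets\<close>

lemma primitive_not_subset: "primitive_collection \<Sigma> U J \<Longrightarrow> \<sigma> \<in> \<Sigma> \<Longrightarrow> \<not> J \<subseteq> labels \<sigma>"
  by (auto simp: primitive_collection_def fan_nonfaces_def)

lemma primitive_cone:
  assumes "primitive_collection \<Sigma> U J" "\<rho> \<in> J"
  shows "cone_over U (J - {\<rho>}) \<in> \<Sigma>" "labels (cone_over U (J - {\<rho>})) = J - {\<rho>}"
proof -
  have "J - {\<rho>} \<notin> fan_nonfaces \<Sigma> U"
    using assms by (auto simp: primitive_collection_def)
  then obtain \<sigma> where "\<sigma> \<in> \<Sigma>" "J - {\<rho>} \<subseteq> labels \<sigma>"
    by (auto simp: fan_nonfaces_def)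
  then show "cone_over U (J - {\<rho>}) \<in> \<Sigma>" "labels (cone_over U (J - {\<rho>})) = J - {\<rho>}"
    using subset_labels by blast+
qed

text \<open>A single ray is already a cone, so a primitive collection is no singleton. This keeps
  the intersection in \<open>cofacet\<close> from running over the empty family, where it would be
  the whole space.\<close>

lemma primitive_other_elem:
  assumes "primitive_collection \<Sigma> U J" "\<rho> \<in> J"
  shows "J - {\<rho>} \<noteq> {}"
proof
  assume "J - {\<rho>} = {}"
  then have "J \<subseteq> labels (ray U \<rho>)"
    by (auto simp: labels_alt[OF ray_in_fan] row_in_ray)
  then show False
    using primitive_not_subset[OF assms(1) ray_in_fan] by blast
qed

lemma primitive_cone_dim:
  assumes "primitive_collection \<Sigma> U J" "\<rho> \<in> J"
  shows "cone_over U (J - {\<rho>}) \<in> fan_cones \<Sigma> (card J - 1)"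
  using primitive_cone[OF assms] assms(2) by (simp add: fan_cones_def dim_cone)

text \<open>Adding \<rho> to the cone would produce a cone containing all of \<open>J\<close>; the
  other elements of \<open>J\<close> are labels of the cone itself.\<close>

lemma primitive_notin_nb:
  assumes "primitive_collection \<Sigma> U J" "\<rho> \<in> J"
  shows "nb \<Sigma> U (cone_over U (J - {\<rho>})) \<inter> J = {}"
proof -
  have "\<rho> \<notin> nb \<Sigma> U (cone_over U (J - {\<rho>}))"
    using primitive_not_subset[OF assms(1)] assms(2)
    by (auto simp: nb_iff[OF primitive_cone(1)[OF assms]] primitive_cone(2)[OF assms] insert_absorb)
  then show ?thesis
    using nb_disjoint[OF primitive_cone(1)[OF assms]] by (auto simp: primitive_cone(2)[OF assms])
qed

end

section \<open>Star fans\<close>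

lemma linear_star_map: "linear (star_map T K)"
  by (rule linearI)
     (simp_all add: star_map_def Finite_Cartesian_Product.vec_eq_iff vector_matrix_left_distrib
        scaleR_vector_matrix_assoc)

lemma row_submatrix_eq_star_map:
  "i \<in> I \<Longrightarrow> submatrix I (- K) (U ** T) $ i = star_map T K (U $ i)"
  by (simp add: submatrix_def star_map_def Finite_Cartesian_Product.vec_eq_iff
      matrix_matrix_mult_def vector_matrix_mult_def mult.commute)

lemma abs_minor_cong:
  fixes A A' :: "real^'d^'n"
  assumes "card R = card C" "\<And>i j. i \<in> R \<Longrightarrow> j \<in> C \<Longrightarrow> A $ i $ j = A' $ i $ j"
  shows "abs_minor A R C = abs_minor A' R C"
proof -
  obtain r where r: "distinct r" "set r = R"
    using finite_distinct_list[of R] by auto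
  obtain c where c: "distinct c" "set c = C"
    using finite_distinct_list[of C] by auto
  have "length r = card C" "length c = card C"
    using distinct_card[OF r(1)] distinct_card[OF c(1)] r c assms(1) by auto
  then have "Matrix.mat (card C) (card C) (\<lambda>(i, j). A $ (r ! i) $ (c ! j)) =
      Matrix.mat (card C) (card C) (\<lambda>(i, j). A' $ (r ! i) $ (c ! j))"
    using r c assms(2) nth_mem by (intro eq_matI) auto
  then show ?thesis
    by (simp add: abs_minor_eq[OF r c assms(1)])
qed

text \<open>Terms with negative coefficients are collected in \<open>q\<close>. Applied to the
  kernel of \<open>star_map\<close>, this turns a relation modulo the span of \<tau> into one
  between cone elements.\<close>

lemma span_diff_of_cone_elements:
  fixes f :: "'i \<Rightarrow> 'a::real_vector"
  assumes "finite I" "v \<in> span (f ` I)"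
  obtains p q where "p \<in> convex_cone hull (f ` I)" "q \<in> convex_cone hull (f ` I)" "v = p - q"
proof -
  let ?H = "convex_cone hull (f ` I)"
  have "\<exists>p\<in>?H. \<exists>q\<in>?H. v = p - q"
    using assms(2)
  proof (induction rule: span_induct_alt)
    case base
    then show ?case
      by (intro bexI[of _ 0]) (auto simp: convex_cone_hull_contains_0)
  next
    case (step c x y)
    then obtain p q where pq: "p \<in> ?H" "q \<in> ?H" "y = p - q" by auto
    have x: "x \<in> ?H" using step by (auto intro: hull_inc)
    show ?case
    proof (cases "c \<ge> 0")
      case True
      then show ?thesis
        using pq x
        by (intro bexI[of _ "c *\<^sub>R x + p"] bexI[of _ q]) (auto intro!: convex_cone_hull_add convex_cone_hull_mul)
    next
      case False
      then show ?thesis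
        using pq x
        by (intro bexI[of _ p] bexI[of _ "(- c) *\<^sub>R x + q"])
           (auto intro!: convex_cone_hull_add convex_cone_hull_mul simp del: scaleR_minus_left, simp)
    qed
  qed
  then show ?thesis using that by blast
qed

locale star_of_cone = simplicial_fan_rays \<Sigma> U
  for \<Sigma> :: "(real^'d) set set" and U :: "real^'d^'n" +
  fixes \<tau> :: "(real^'d) set" and T :: "real^'d^'d" and K :: "'d set"
  assumes cone_in_fan: "\<tau> \<in> \<Sigma>" and adapted: "adapted U \<tau> T K"
begin

abbreviation N :: "'n set" where "N \<equiv> nb \<Sigma> U \<tau>"
abbreviation A :: "real^'d^'n" where "A \<equiv> submatrix N (- K) (U ** T)"

lemma star_map_zero_iff: "star_map T K v = 0 \<longleftrightarrow> v \<in> span (($) U ` labels \<tau>)"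
  by (rule star_map_eq_0_iff[OF adapted])

lemma row_A: "i \<in> N \<Longrightarrow> A $ i = star_map T K (U $ i)"
  by (rule row_submatrix_eq_star_map)

text \<open>A relation between the images says that a combination of rows outside \<tau> lies in the
  span of \<tau>. Both sides are combinations of the independent rows of \<sigma> with disjoint
  supports, so all coefficients vanish.\<close>

lemma indep_star:
  assumes "\<sigma> \<in> \<Sigma>" "labels \<tau> \<subseteq> labels \<sigma>"
  shows "indep_family (($) A) (labels \<sigma> - labels \<tau>)"
  unfolding indep_family_def
proof (intro allI impI)
  fix c
  let ?M = "labels \<sigma> - labels \<tau>"
  have MN: "?M \<subseteq> N"
    using labels_diff_subset_nb[OF cone_in_fan assms] .
  assume "(\<Sum>i\<in>?M. c i *\<^sub>R A $ i) = 0"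
  also have "(\<Sum>i\<in>?M. c i *\<^sub>R A $ i) = (\<Sum>i\<in>?M. star_map T K (c i *\<^sub>R U $ i))"
    using MN by (intro sum.cong) (auto simp: row_A linear_scale[OF linear_star_map])
  also have "\<dots> = star_map T K (\<Sum>i\<in>?M. c i *\<^sub>R U $ i)"
    by (simp add: linear_sum[OF linear_star_map])
  finally have "(\<Sum>i\<in>?M. c i *\<^sub>R U $ i) \<in> span (($) U ` labels \<tau>)"
    by (simp add: star_map_zero_iff)
  then obtain p q where pq: "p \<in> convex_cone hull (($) U ` labels \<tau>)"
    "q \<in> convex_cone hull (($) U ` labels \<tau>)" "(\<Sum>i\<in>?M. c i *\<^sub>R U $ i) = p - q"
    by (rule span_diff_of_cone_elements[OF finite])
  then obtain e e' where e: "p = (\<Sum>i\<in>labels \<tau>. e i *\<^sub>R U $ i)" "q = (\<Sum>i\<in>labels \<tau>. e' i *\<^sub>R U $ i)"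
    by (auto simp: convex_cone_hull_explicit)
  have "(\<Sum>i\<in>labels \<sigma>. (if i \<in> ?M then c i else 0) *\<^sub>R U $ i)
      = (\<Sum>i\<in>labels \<sigma>. (if i \<in> labels \<tau> then e i - e' i else 0) *\<^sub>R U $ i)"
    unfolding sum_scaleR_extend[OF finite Diff_subset, symmetric] sum_scaleR_extend[OF finite assms(2), symmetric]
    using pq(3) e by (simp add: scaleR_diff_left sum_subtractf)
  from indep_family_eqD[OF indep_labels[OF assms(1)] this]
  show "\<forall>i\<in>?M. c i = 0" by fastforce
qed

text \<open>Linear images commute with conic hulls, and the generators in \<tau> are sent to
  0.\<close>

lemma star_cone_eq:
  assumes "\<sigma> \<in> \<Sigma>" "labels \<tau> \<subseteq> labels \<sigma>"
  shows "star_map T K ` \<sigma> = convex_cone hull (($) A ` (labels \<sigma> - labels \<tau>))"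
proof -
  let ?M = "labels \<sigma> - labels \<tau>" and ?f = "star_map T K"
  have MN: "?M \<subseteq> N"
    using labels_diff_subset_nb[OF cone_in_fan assms] .
  have "?f ` \<sigma> = convex_cone hull (?f ` ($) U ` labels \<sigma>)"
    by (subst cone_eq_hull[OF assms(1)]) (rule convex_cone_hull_linear_image[OF linear_star_map, symmetric])
  also have "\<dots> = convex_cone hull (($) A ` ?M)"
  proof (intro subset_antisym hull_minimal convex_cone_convex_cone_hull subsetI)
    fix v assume "v \<in> ?f ` ($) U ` labels \<sigma>"
    then obtain i where i: "i \<in> labels \<sigma>" "v = ?f (U $ i)" by auto
    show "v \<in> convex_cone hull (($) A ` ?M)"
    proof (cases "i \<in> labels \<tau>")
      case True
      then have "v = 0" by (auto simp: i star_map_zero_iff intro: span_base)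
      then show ?thesis by (simp add: convex_cone_hull_contains_0)
    next
      case False
      then have "v \<in> ($) A ` ?M" using i MN by (auto simp: row_A intro!: image_eqI[of _ _ i])
      then show ?thesis by (rule hull_inc)
    qed
  next
    fix v assume "v \<in> ($) A ` ?M"
    then show "v \<in> convex_cone hull (?f ` ($) U ` labels \<sigma>)"
      using MN by (auto simp: row_A intro!: hull_inc)
  qed
  finally show ?thesis .
qed

lemma row_A_nonzero:
  assumes "i \<in> N" shows "A $ i \<noteq> 0"
proof -
  obtain \<sigma> where \<sigma>: "\<sigma> \<in> \<Sigma>" "insert i (labels \<tau>) \<subseteq> labels \<sigma>" "i \<notin> labels \<tau>"
    using assms nb_iff[OF cone_in_fan] by auto
  then have "independent (($) A ` (labels \<sigma> - labels \<tau>))"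
    by (intro indep_family_independent indep_star) auto
  then have "0 \<notin> ($) A ` (labels \<sigma> - labels \<tau>)"
    by (meson dependent_zero)
  then show ?thesis using \<sigma> by (metis DiffI imageI insert_subset)
qed

text \<open>Two neighbours with the same image ray give points in the relative interiors of the two cones
  that they span with \<open>\<tau>\<close>, up to adding elements of \<open>\<tau>\<close>; such cones meet only in \<open>\<tau>\<close>.\<close>

lemma nb_eq_of_parallel:
  assumes i: "i \<in> N" and j: "j \<in> N" and c: "c \<ge> 0" "A $ j = c *\<^sub>R A $ i"
  shows "i = j"
proof (rule ccontr)
  assume "i \<noteq> j"
  have "\<exists>\<sigma>\<in>\<Sigma>. labels \<sigma> = insert k (labels \<tau>)" if "k \<in> N" for k
    using that subset_labels[of _ "insert k (labels \<tau>)"] unfolding nb_iff[OF cone_in_fan] by metis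
  then obtain \<sigma>i \<sigma>j where \<sigma>: "\<sigma>i \<in> \<Sigma>" "labels \<sigma>i = insert i (labels \<tau>)"
    "\<sigma>j \<in> \<Sigma>" "labels \<sigma>j = insert j (labels \<tau>)"
    using i j by metis
  have "U $ j - c *\<^sub>R U $ i \<in> span (($) U ` labels \<tau>)"
    unfolding star_map_zero_iff[symmetric]
    using i j c by (simp add: row_A linear_diff[OF linear_star_map] linear_scale[OF linear_star_map])
  then obtain p q where pq: "p \<in> convex_cone hull (($) U ` labels \<tau>)"
    "q \<in> convex_cone hull (($) U ` labels \<tau>)" "U $ j - c *\<^sub>R U $ i = p - q"
    by (rule span_diff_of_cone_elements[OF finite])
  have sub: "convex_cone hull (($) U ` labels \<tau>) \<subseteq> convex_cone hull (($) U ` insert k (labels \<tau>))" for k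
    by (intro hull_mono) auto
  have row: "U $ k \<in> convex_cone hull (($) U ` insert k (labels \<tau>))" for k
    by (intro hull_inc) auto
  \<comment> \<open>Moving both cone elements to the side with a plus sign gives one point that lies
    in both cones, hence in their common face \<tau>.\<close>
  have eq: "U $ j + q = c *\<^sub>R U $ i + p"
    using pq(3) by (simp add: algebra_simps)
  have "U $ j + q \<in> \<sigma>j"
    using pq sub[of j] row[of j] cone_eq_hull[OF \<sigma>(3)] \<sigma>(4) convex_cone_hull_add by (metis subsetD)
  moreover have "c *\<^sub>R U $ i + p \<in> \<sigma>i"
    using pq sub[of i] row[of i] cone_eq_hull[OF \<sigma>(1)] \<sigma>(2) convex_cone_hull_add convex_cone_hull_mul c
    by (metis subsetD)
  ultimately have "U $ j + q \<in> cone_over U (labels \<sigma>i \<inter> labels \<sigma>j)"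
    using Int_subset_cone_over[OF \<sigma>(1,3)] eq by auto
  also have "labels \<sigma>i \<inter> labels \<sigma>j = labels \<tau>"
    using \<sigma>(2,4) \<open>i \<noteq> j\<close> i j nb_disjoint[OF cone_in_fan] by auto
  finally have "U $ j + q \<in> span (($) U ` labels \<tau>)"
    unfolding cone_over_def by (metis hull_inc hull_subset span_base span_convex_cone_hull)
  moreover have "q \<in> span (($) U ` labels \<tau>)"
    using pq(2) by (metis span_base span_convex_cone_hull)
  ultimately have "U $ j \<in> span (($) U ` labels \<tau>)"
    using span_diff by fastforce
  then show False
    using row_A_nonzero[OF j] j by (simp add: row_A star_map_zero_iff)
qed

text \<open>By independence every remaining generator spans a face. Conversely, a face ray contains
  the image of some remaining generator, and by \<open>nb_eq_of_parallel\<close> this can only be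
  the generator with the same label.\<close>

lemma star_labels:
  assumes "\<sigma> \<in> \<Sigma>" "labels \<tau> \<subseteq> labels \<sigma>"
  shows "ray_labels A N (star_map T K ` \<sigma>) = labels \<sigma> - labels \<tau>"
proof
  let ?M = "labels \<sigma> - labels \<tau>"
  have MN: "?M \<subseteq> N"
    using labels_diff_subset_nb[OF cone_in_fan assms] .
  show "?M \<subseteq> ray_labels A N (star_map T K ` \<sigma>)"
  proof
    fix i assume "i \<in> ?M"
    then show "i \<in> ray_labels A N (star_map T K ` \<sigma>)"
      using MN subcone_face_of[OF indep_star[OF assms], of "{i}"]
      by (auto simp: ray_labels_def ray_def star_cone_eq[OF assms])
  qed
  show "ray_labels A N (star_map T K ` \<sigma>) \<subseteq> ?M"
  proof
    fix i assume "i \<in> ray_labels A N (star_map T K ` \<sigma>)"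
    then have i: "i \<in> N" "ray A i face_of convex_cone hull (($) A ` ?M)"
      by (auto simp: ray_labels_def star_cone_eq[OF assms])
    have Ai: "A $ i \<in> ray A i" by (simp add: ray_def hull_inc)
    from face_of_convex_cone_hull[OF i(2)] Ai
    have "ray A i = convex_cone hull (($) A ` {j \<in> ?M. A $ j \<in> ray A i})" by auto
    then have "{j \<in> ?M. A $ j \<in> ray A i} \<noteq> {}"
      using Ai row_A_nonzero[OF i(1)]
      by (metis (no_types, lifting) convex_cone_hull_empty image_empty singletonD)
    then obtain j where j: "j \<in> ?M" "A $ j \<in> ray A i" by auto
    then obtain c where "c \<ge> 0" "A $ j = c *\<^sub>R A $ i"
      by (auto simp: ray_def in_convex_cone_hull_singleton)
    then have "i = j"
      using nb_eq_of_parallel i(1) j(1) MN by blast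
    then show "i \<in> ?M" using j by simp
  qed
qed

section \<open>Full-dimensional cones of the star fan and its adjoint\<close>

lemma card_K: "card K = card (labels \<tau>)"
proof -
  have "card (labels \<tau>) = card ((\<lambda>j. axis j 1 :: real^'d) ` K)"
    using adapted bij_betw_same_card by (auto simp: adapted_def)
  also have "\<dots> = card K"
    by (intro card_image) (auto simp: inj_on_def axis_eq_axis)
  finally show ?thesis by simp
qed

lemma card_compl_K: "card (- K) + card (labels \<tau>) = CARD('d)"
  using card_Un_disjoint[of "- K" K] by (simp add: card_K Compl_partition2)

definition maximal_cones :: "(real^'d) set set" where
  "maximal_cones = {\<sigma> \<in> fan_cones \<Sigma> CARD('d). labels \<tau> \<subseteq> labels \<sigma>}"

lemma maximal_conesD:
  assumes "\<sigma> \<in> maximal_cones"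
  shows "\<sigma> \<in> \<Sigma>" "labels \<tau> \<subseteq> labels \<sigma>" "card (labels \<sigma>) = CARD('d)"
    "card (labels \<sigma> - labels \<tau>) = card (- K)"
  using assms dim_cone card_compl_K
  by (auto simp: maximal_cones_def fan_cones_def card_Diff_subset)

lemma inj_on_star_cone: "inj_on (\<lambda>\<sigma>. star_map T K ` \<sigma>) {\<sigma> \<in> \<Sigma>. labels \<tau> \<subseteq> labels \<sigma>}"
proof (rule inj_onI)
  fix \<sigma> \<sigma>' assume *: "\<sigma> \<in> {\<sigma> \<in> \<Sigma>. labels \<tau> \<subseteq> labels \<sigma>}" "\<sigma>' \<in> {\<sigma> \<in> \<Sigma>. labels \<tau> \<subseteq> labels \<sigma>}"
    "star_map T K ` \<sigma> = star_map T K ` \<sigma>'"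
  then have "labels \<sigma> - labels \<tau> = labels \<sigma>' - labels \<tau>"
    using star_labels by (metis (mono_tags, lifting) mem_Collect_eq)
  then show "\<sigma> = \<sigma>'"
    using * labels_inject by blast
qed

text \<open>Passing to the quotient lowers the dimension of every cone above \<tau> by the number of
  labels of \<tau>, which is also the number of columns in \<open>K\<close>.\<close>

lemma fan_cones_star_fan:
  "fan_cones (star_fan \<Sigma> \<tau> T K) (card (- K)) = (\<lambda>\<sigma>. star_map T K ` \<sigma>) ` maximal_cones"
proof -
  have dim: "dim (star_map T K ` \<sigma>) + card (labels \<tau>) = dim \<sigma>"
    if "\<sigma> \<in> \<Sigma>" "labels \<tau> \<subseteq> labels \<sigma>" for \<sigma>
    using dim_convex_cone_hull[OF indep_star[OF that]] card_mono[OF _ that(2)]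
    by (simp add: star_cone_eq[OF that] dim_cone[OF that(1)] card_Diff_subset that(2))
  have "dim (star_map T K ` \<sigma>) = card (- K) \<longleftrightarrow> dim \<sigma> = CARD('d)"
    if "\<sigma> \<in> \<Sigma>" "labels \<tau> \<subseteq> labels \<sigma>" for \<sigma>
    using dim[OF that] card_compl_K by linarith
  then show ?thesis
    using face_of_iff_labels[OF _ cone_in_fan]
    by (auto simp: fan_cones_def star_fan_def maximal_cones_def)
qed

lemma abs_minor_star:
  assumes "\<sigma> \<in> maximal_cones"
  shows "abs_minor A (labels \<sigma> - labels \<tau>) (- K) =
    abs_minor T UNIV UNIV * abs_minor U (labels \<sigma>) UNIV"
proof -
  note \<sigma> = maximal_conesD[OF assms]
  \<comment> \<open>The zero padding of \<open>submatrix\<close> lies outside the rows and columns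
    of this minor.\<close>
  have "abs_minor A (labels \<sigma> - labels \<tau>) (- K) = abs_minor (U ** T) (labels \<sigma> - labels \<tau>) (- K)"
    using labels_diff_subset_nb[OF cone_in_fan \<sigma>(1,2)] \<sigma>(4)
    by (intro abs_minor_cong) (auto simp: submatrix_def)
  \<comment> \<open>The rows of \<tau> in \<open>U ** T\<close> are the unit vectors of
    \<open>K\<close>, so restoring them does not change the minor.\<close>
  also have "\<dots> = abs_minor (U ** T) (labels \<sigma>) UNIV"
    using adapted \<sigma> by (intro abs_minor_unit_rows[symmetric]) (auto simp: adapted_def)
  also have "\<dots> = abs_minor U (labels \<sigma>) UNIV * abs_minor T UNIV UNIV"
    by (rule abs_minor_mult[OF \<sigma>(3)])
  finally show ?thesis by simp
qed

text \<open>\<open>star_fan\<close> is injective on the cones above \<tau>, so the sum can run over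
  cones of \<Sigma> itself, with minors of \<open>U\<close> in place of those of
  \<open>U_\<tau>\<close>.\<close>

lemma star_adjoint_eq:
  "star_adjoint \<Sigma> U \<tau> T K x = of_real (abs_minor T UNIV UNIV) *
     (\<Sum>\<sigma>\<in>maximal_cones. of_real (abs_minor U (labels \<sigma>) UNIV) * (\<Prod>i\<in>N - labels \<sigma>. x $ i))"
proof -
  have inj: "inj_on (\<lambda>\<sigma>. star_map T K ` \<sigma>) maximal_cones"
    by (rule inj_on_subset[OF inj_on_star_cone]) (auto dest: maximal_conesD)
  have "star_adjoint \<Sigma> U \<tau> T K x = (\<Sum>\<sigma>\<in>maximal_cones.
      of_real (abs_minor A (labels \<sigma> - labels \<tau>) (- K)) * (\<Prod>i\<in>N - (labels \<sigma> - labels \<tau>). x $ i))"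
    by (simp add: star_adjoint_def adj_def fan_cones_star_fan sum.reindex[OF inj]
        star_labels maximal_conesD)
  also have "\<dots> = (\<Sum>\<sigma>\<in>maximal_cones. of_real (abs_minor T UNIV UNIV) *
      (of_real (abs_minor U (labels \<sigma>) UNIV) * (\<Prod>i\<in>N - labels \<sigma>. x $ i)))"
  proof (rule sum.cong[OF refl])
    fix \<sigma> assume \<sigma>: "\<sigma> \<in> maximal_cones"
    have "N - (labels \<sigma> - labels \<tau>) = N - labels \<sigma>"
      using nb_disjoint[OF cone_in_fan] by auto
    then show "of_real (abs_minor A (labels \<sigma> - labels \<tau>) (- K)) * (\<Prod>i\<in>N - (labels \<sigma> - labels \<tau>). x $ i) =
      of_real (abs_minor T UNIV UNIV) *
      (of_real (abs_minor U (labels \<sigma>) UNIV) * (\<Prod>i\<in>N - labels \<sigma>. x $ i))"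
      by (simp add: abs_minor_star[OF \<sigma>] mult.assoc)
  qed
  finally show ?thesis by (simp add: sum_distrib_left)
qed

end

section \<open>Partial derivatives of the adjoint\<close>

text \<open>Equations may be exchanged when they are equivalent merely modulo \<open>F\<close>; here
  \<open>F\<close> will consist of the coordinates in \<open>J\<close>.\<close>

lemma zero_locus_Int_eq:
  assumes "\<And>x. \<forall>f\<in>F. f x = 0 \<Longrightarrow> (\<forall>f\<in>E. f x = 0) \<longleftrightarrow> (\<forall>f\<in>G. f x = 0)"
  shows "zero_locus E \<inter> zero_locus F = zero_locus (F \<union> G)"
proof -
  have *: "(\<forall>f\<in>F \<union> G. f x = 0) \<longleftrightarrow> (\<forall>f\<in>E. f x = 0) \<and> (\<forall>f\<in>F. f x = 0)" for x
    using assms[of x] by (auto simp: ball_Un)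
  show ?thesis
    unfolding zero_locus_def * by auto
qed

lemma ball_Collect_image: "(\<forall>f\<in>{h i | i. P i}. Q f) \<longleftrightarrow> (\<forall>i. P i \<longrightarrow> Q (h i))"
  by auto

context simplicial_fan_rays
begin

text \<open>All monomials are squarefree. As a function of one variable each is constant or linear,
  and only the linear ones contribute.\<close>

lemma partial_deriv_universal_adjoint:
  fixes x :: "complex^'n"
  shows "partial_deriv \<rho> (universal_adjoint \<Sigma> U) x =
    (\<Sum>\<sigma> | \<sigma> \<in> fan_cones \<Sigma> CARD('d) \<and> \<rho> \<notin> labels \<sigma>.
       of_real (abs_minor U (labels \<sigma>) UNIV) * (\<Prod>i\<in>- labels \<sigma> - {\<rho>}. x $ i))"
proof -
  let ?S = "fan_cones \<Sigma> CARD('d)"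
  have fin: "finite ?S" using finite_fan by (simp add: fan_cones_def)
  define a where "a \<sigma> = complex_of_real (abs_minor U (labels \<sigma>) UNIV)" for \<sigma>
  \<comment> \<open>The part of the monomial that is free of the variable of \<rho>.\<close>
  define q where "q \<sigma> = (\<Prod>i\<in>- labels \<sigma> - {\<rho>}. x $ i)" for \<sigma>
  have "universal_adjoint \<Sigma> U (\<chi> j. if j = \<rho> then t else x $ j) =
      (\<Sum>\<sigma>\<in>?S. a \<sigma> * ((if \<rho> \<in> labels \<sigma> then 1 else t) * q \<sigma>))" for t
    unfolding adj_def
  proof (intro sum.cong)
    fix \<sigma>
    have q: "(\<Prod>i\<in>- labels \<sigma> - {\<rho>}. if i = \<rho> then t else x $ i) = q \<sigma>"
      unfolding q_def by (intro prod.cong) auto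
    have "(\<Prod>i\<in>- labels \<sigma>. if i = \<rho> then t else x $ i) = (if \<rho> \<in> labels \<sigma> then 1 else t) * q \<sigma>"
    proof (cases "\<rho> \<in> labels \<sigma>")
      case True
      then have "- labels \<sigma> = - labels \<sigma> - {\<rho>}" by auto
      then show ?thesis using True q by simp
    next
      case False
      then show ?thesis
        using q by (subst prod.remove[of _ \<rho>]) auto
    qed
    then show "of_real (abs_minor U (labels \<sigma>) UNIV) *
        (\<Prod>i\<in>UNIV - labels \<sigma>. (\<chi> j. if j = \<rho> then t else x $ j) $ i) =
        a \<sigma> * ((if \<rho> \<in> labels \<sigma> then 1 else t) * q \<sigma>)"
      by (simp add: a_def Compl_eq_Diff_UNIV)
  qed simp
  moreover have "((\<lambda>t. \<Sum>\<sigma>\<in>?S. a \<sigma> * ((if \<rho> \<in> labels \<sigma> then 1 else t) * q \<sigma>))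
      has_field_derivative (\<Sum>\<sigma>\<in>?S. a \<sigma> * ((if \<rho> \<in> labels \<sigma> then 0 else 1) * q \<sigma>))) (at (x $ \<rho>))"
  proof (intro DERIV_sum)
    fix \<sigma>
    show "((\<lambda>t. a \<sigma> * ((if \<rho> \<in> labels \<sigma> then 1 else t) * q \<sigma>))
      has_field_derivative a \<sigma> * ((if \<rho> \<in> labels \<sigma> then 0 else 1) * q \<sigma>)) (at (x $ \<rho>))"
      by (cases "\<rho> \<in> labels \<sigma>") (auto intro!: derivative_eq_intros)
  qed
  ultimately have "partial_deriv \<rho> (universal_adjoint \<Sigma> U) x =
      (\<Sum>\<sigma>\<in>?S. a \<sigma> * ((if \<rho> \<in> labels \<sigma> then 0 else 1) * q \<sigma>))"
    unfolding partial_deriv_def by (simp add: DERIV_imp_deriv)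
  also have "\<dots> = (\<Sum>\<sigma> | \<sigma> \<in> ?S \<and> \<rho> \<notin> labels \<sigma>. a \<sigma> * q \<sigma>)"
    by (rule sum.mono_neutral_cong_right) (use fin in auto)
  finally show ?thesis by (simp add: a_def q_def)
qed

text \<open>A cone contributes only if it misses no element of \<open>J\<close> other than \<rho>.
  The condition \<open>\<rho> \<in> J\<close> stands in the index set, so that the sum is empty for
  all other labels.\<close>

lemma partial_deriv_on_coord_subspace:
  assumes J: "primitive_collection \<Sigma> U J" and x: "\<And>i. i \<in> J \<Longrightarrow> x $ i = 0"
  shows "partial_deriv \<rho> (universal_adjoint \<Sigma> U) x =
    (\<Sum>\<sigma> | \<sigma> \<in> fan_cones \<Sigma> CARD('d) \<and> \<rho> \<in> J \<and> J - {\<rho>} \<subseteq> labels \<sigma>.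
       of_real (abs_minor U (labels \<sigma>) UNIV) * (\<Prod>i\<in>- labels \<sigma> - {\<rho>}. x $ i))"
  unfolding partial_deriv_universal_adjoint
proof (rule sum.mono_neutral_right)
  show "finite {\<sigma> \<in> fan_cones \<Sigma> CARD('d). \<rho> \<notin> labels \<sigma>}"
    using finite_fan by (simp add: fan_cones_def)
  show "{\<sigma> \<in> fan_cones \<Sigma> CARD('d). \<rho> \<in> J \<and> J - {\<rho>} \<subseteq> labels \<sigma>}
      \<subseteq> {\<sigma> \<in> fan_cones \<Sigma> CARD('d). \<rho> \<notin> labels \<sigma>}"
    using primitive_not_subset[OF J] by (auto simp: fan_cones_def)
  show "\<forall>\<sigma>\<in>{\<sigma> \<in> fan_cones \<Sigma> CARD('d). \<rho> \<notin> labels \<sigma>} -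
        {\<sigma> \<in> fan_cones \<Sigma> CARD('d). \<rho> \<in> J \<and> J - {\<rho>} \<subseteq> labels \<sigma>}.
      of_real (abs_minor U (labels \<sigma>) UNIV) * (\<Prod>i\<in>- labels \<sigma> - {\<rho>}. x $ i) = 0"
  proof
    fix \<sigma> assume \<sigma>: "\<sigma> \<in> {\<sigma> \<in> fan_cones \<Sigma> CARD('d). \<rho> \<notin> labels \<sigma>} -
        {\<sigma> \<in> fan_cones \<Sigma> CARD('d). \<rho> \<in> J \<and> J - {\<rho>} \<subseteq> labels \<sigma>}"
    then have "\<not> J \<subseteq> labels \<sigma>"
      using primitive_not_subset[OF J] by (auto simp: fan_cones_def)
    \<comment> \<open>If \<rho> were the only element of \<open>J\<close> missing from \<sigma>,
      then \<sigma> would belong to the smaller index set.\<close>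
    with \<sigma> obtain i where "i \<in> J" "i \<notin> labels \<sigma>" "i \<noteq> \<rho>" by auto
    then have "(\<Prod>i\<in>- labels \<sigma> - {\<rho>}. x $ i) = 0"
      using x by (intro prod_zero) auto
    then show "of_real (abs_minor U (labels \<sigma>) UNIV) * (\<Prod>i\<in>- labels \<sigma> - {\<rho>}. x $ i) = 0"
      by simp
  qed
qed

lemma partial_deriv_outside:
  assumes "primitive_collection \<Sigma> U J" "\<And>i. i \<in> J \<Longrightarrow> x $ i = 0" "\<rho> \<notin> J"
  shows "partial_deriv \<rho> (universal_adjoint \<Sigma> U) x = 0"
  using assms by (simp add: partial_deriv_on_coord_subspace)

text \<open>The derivative and the star adjoint are sums over the same cones. Their monomials differ
  by the variables that are neither neighbours nor in \<open>J\<close>, and their minors by the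
  factor of \<open>T\<close>.\<close>

lemma partial_deriv_star_adjoint:
  assumes J: "primitive_collection \<Sigma> U J" and x: "\<And>i. i \<in> J \<Longrightarrow> x $ i = 0" and \<rho>: "\<rho> \<in> J"
    and ad: "adapted U (cone_over U (J - {\<rho>})) T K"
  shows "of_real (abs_minor T UNIV UNIV) * partial_deriv \<rho> (universal_adjoint \<Sigma> U) x =
    (\<Prod>\<rho>' | \<rho>' \<notin> nb \<Sigma> U (cone_over U (J - {\<rho>})) \<and> \<rho>' \<notin> J. x $ \<rho>') *
      star_adjoint \<Sigma> U (cone_over U (J - {\<rho>})) T K x"
proof -
  let ?\<tau> = "cone_over U (J - {\<rho>})"
  interpret star_of_cone \<Sigma> U ?\<tau> T K
    by unfold_locales (use primitive_cone[OF J \<rho>] ad in auto)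
  note lab = primitive_cone(2)[OF J \<rho>]
  let ?E = "{\<rho>'. \<rho>' \<notin> N \<and> \<rho>' \<notin> J}"
  have "partial_deriv \<rho> (universal_adjoint \<Sigma> U) x =
    (\<Sum>\<sigma>\<in>maximal_cones. of_real (abs_minor U (labels \<sigma>) UNIV) * (\<Prod>i\<in>- labels \<sigma> - {\<rho>}. x $ i))"
    using \<rho> by (simp add: partial_deriv_on_coord_subspace[OF J x] maximal_cones_def lab)
  also have "\<dots> = (\<Sum>\<sigma>\<in>maximal_cones. (\<Prod>i\<in>?E. x $ i) *
      (of_real (abs_minor U (labels \<sigma>) UNIV) * (\<Prod>i\<in>N - labels \<sigma>. x $ i)))"
  proof (rule sum.cong[OF refl])
    fix \<sigma> assume "\<sigma> \<in> maximal_cones"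
    note \<sigma> = maximal_conesD[OF this]
    \<comment> \<open>Labels of \<sigma> are neighbours or elements of \<open>J - {\<rho>}\<close>,
      and \<sigma> contains all of the latter; moreover no element of \<open>J\<close> is a
      neighbour.\<close>
    have "- labels \<sigma> - {\<rho>} = ?E \<union> (N - labels \<sigma>)"
      using labels_diff_subset_nb[OF cone_in_fan \<sigma>(1,2)] \<sigma>(2) primitive_notin_nb[OF J \<rho>] \<rho>
      unfolding lab by blast
    moreover have "(\<Prod>i\<in>?E \<union> (N - labels \<sigma>). x $ i) = (\<Prod>i\<in>?E. x $ i) * (\<Prod>i\<in>N - labels \<sigma>. x $ i)"
      by (rule prod.union_disjoint) auto
    ultimately show "of_real (abs_minor U (labels \<sigma>) UNIV) * (\<Prod>i\<in>- labels \<sigma> - {\<rho>}. x $ i) =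
        (\<Prod>i\<in>?E. x $ i) * (of_real (abs_minor U (labels \<sigma>) UNIV) * (\<Prod>i\<in>N - labels \<sigma>. x $ i))"
      by simp
  qed
  finally show ?thesis
    by (simp add: star_adjoint_eq sum_distrib_left mult.left_commute)
qed

lemma sing_adjoint_Int_coord_subspace:
  assumes J: "primitive_collection \<Sigma> U J"
    and ad: "\<forall>\<rho>\<in>J. adapted U (cone_over U (J - {\<rho>})) (T \<rho>) (K \<rho>)"
  shows "sing_adjoint \<Sigma> U \<inter> coord_subspace J =
       zero_locus
         ({(\<lambda>x. x $ \<rho>) | \<rho>. \<rho> \<in> J} \<union>
          {(\<lambda>x. (\<Prod>\<rho>' | \<rho>' \<notin> nb \<Sigma> U (cone_over U (J - {\<rho>})) \<and> \<rho>' \<notin> J. x $ \<rho>') *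
                star_adjoint \<Sigma> U (cone_over U (J - {\<rho>})) (T \<rho>) (K \<rho>) x) | \<rho>. \<rho> \<in> J})"
    (is "_ = zero_locus ({(\<lambda>x. x $ \<rho>) | \<rho>. \<rho> \<in> J} \<union> {?g \<rho> | \<rho>. \<rho> \<in> J})")
proof -
  let ?D = "\<lambda>\<rho>. partial_deriv \<rho> (universal_adjoint \<Sigma> U)"
  have "(\<forall>\<rho>. ?D \<rho> x = 0) \<longleftrightarrow> (\<forall>\<rho>\<in>J. ?g \<rho> x = 0)" if x: "\<forall>i\<in>J. x $ i = 0" for x :: "complex^'n"
  proof -
    have "?D \<rho> x = 0 \<longleftrightarrow> ?g \<rho> x = 0" if "\<rho> \<in> J" for \<rho>
    proof -
      have ad_\<rho>: "adapted U (cone_over U (J - {\<rho>})) (T \<rho>) (K \<rho>)"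
        using ad that by blast
      have eq: "of_real (abs_minor (T \<rho>) UNIV UNIV) * ?D \<rho> x = ?g \<rho> x"
        by (rule partial_deriv_star_adjoint[OF J _ that ad_\<rho>]) (use x in blast)
      have "abs_minor (T \<rho>) UNIV UNIV \<noteq> 0"
        using ad_\<rho> by (intro abs_minor_invertible) (simp add: adapted_def)
      then show ?thesis
        unfolding eq[symmetric] by simp
    qed
    then show ?thesis
      using partial_deriv_outside[OF J, of x] x by blast
  qed
  then have "(\<forall>f\<in>{?D \<rho> | \<rho>. True}. f x = 0) \<longleftrightarrow> (\<forall>f\<in>{?g \<rho> | \<rho>. \<rho> \<in> J}. f x = 0)"
    if "\<forall>f\<in>{(\<lambda>x. x $ \<rho>) | \<rho>. \<rho> \<in> J}. f x = 0" for x :: "complex^'n"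
    using that unfolding ball_Collect_image by (simp add: Ball_def)
  then show ?thesis
    unfolding sing_adjoint_def coord_subspace_def by (rule zero_locus_Int_eq)
qed

end

section \<open>Normal fans\<close>

lemma convex_cone_normal_cone: "convex_cone (normal_cone P F)"
  by (auto simp: convex_cone_iff normal_cone_def inner_left_distrib intro: add_mono mult_left_mono)

lemma normal_cone_antimono: "F \<subseteq> G \<Longrightarrow> normal_cone P G \<subseteq> normal_cone P F"
  by (auto simp: normal_cone_def)

text \<open>Faces of a polytope are exposed, and the normal of a hyperplane exposing
  \<open>G\<close> lies in the normal cone of \<open>G\<close>. If it also lies in that of
  \<open>F\<close>, then \<open>F\<close> is contained in the hyperplane.\<close>

lemma normal_cone_subset_iff:
  assumes "polytope P" "F face_of P" "G face_of P" "G \<noteq> {}"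
  shows "normal_cone P G \<subseteq> normal_cone P F \<longleftrightarrow> F \<subseteq> G"
proof
  assume sub: "normal_cone P G \<subseteq> normal_cone P F"
  have "G exposed_face_of P"
    using assms exposed_face_of_polyhedron polytope_imp_polyhedron by blast
  then obtain a b where ab: "P \<subseteq> {x. a \<bullet> x \<le> b}" "G = P \<inter> {x. a \<bullet> x = b}"
    by (auto simp: exposed_face_of_def)
  obtain g where g: "g \<in> G" using assms by auto
  \<comment> \<open>The sign changes because \<open>a\<close> attains its maximum on
    \<open>G\<close>, whereas normal cones consist of inner normals.\<close>
  have "- a \<in> normal_cone P G"
    using ab by (auto simp: normal_cone_def)
  then have "- a \<in> normal_cone P F" using sub by auto
  then have "a \<bullet> x \<ge> b" if "x \<in> F" for x
    using that g ab by (auto simp: normal_cone_def)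
  then show "F \<subseteq> G"
    using ab face_of_imp_subset[OF assms(2)] by fastforce
qed (rule normal_cone_antimono)

lemma normal_cone_inject:
  assumes "polytope P" "F face_of P" "F \<noteq> {}" "G face_of P" "G \<noteq> {}"
  shows "normal_cone P F = normal_cone P G \<longleftrightarrow> F = G"
  using normal_cone_subset_iff[of P F G] normal_cone_subset_iff[of P G F] assms by blast

text \<open>A functional that is minimal at every point of \<open>P\<close> is constant on
  \<open>P\<close>, hence on its affine hull, which is the whole space.\<close>

lemma normal_cone_full_dim:
  fixes P :: "(real^'d) set"
  assumes "aff_dim P = int CARD('d)"
  shows "normal_cone P P = {0}"
proof -
  have "affine hull P = UNIV"
    using assms by (simp add: aff_dim_eq_full[symmetric])
  have "P \<noteq> {}" using assms by auto
  then obtain p where p: "p \<in> P" by auto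
  have "u = 0" if u: "u \<in> normal_cone P P" for u
  proof -
    have "P \<subseteq> {x. u \<bullet> x = u \<bullet> p}"
    proof
      fix x assume "x \<in> P"
      then have "u \<bullet> x \<le> u \<bullet> p" "u \<bullet> p \<le> u \<bullet> x"
        using u p by (simp_all add: normal_cone_def)
      then show "x \<in> {x. u \<bullet> x = u \<bullet> p}" by simp
    qed
    then have "affine hull P \<subseteq> {x. u \<bullet> x = u \<bullet> p}"
      by (intro hull_minimal affine_hyperplane)
    then have *: "u \<bullet> x = u \<bullet> p" for x
      unfolding \<open>affine hull P = UNIV\<close> by auto
    show "u = 0" using *[of 0] *[of u] by simp
  qed
  then show ?thesis by (auto simp: normal_cone_def)
qed

section \<open>Dictionary between cones of the normal fan and faces of the polytope\<close>

locale polytope_normal_fan = simplicial_fan_rays "normal_fan P" U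
  for P :: "(real^'d) set" and U :: "real^'d^'n" +
  assumes polytope: "polytope P" and full_dim: "aff_dim P = int CARD('d)"
begin

lemma P_face: "P face_of P" "P \<noteq> {}"
  using face_of_refl polytope_imp_convex[OF polytope] full_dim by auto

lemma normal_cone_in_fan: "F face_of P \<Longrightarrow> F \<noteq> {} \<Longrightarrow> normal_cone P F \<in> normal_fan P"
  by (auto simp: normal_fan_def)

text \<open>A ray is the normal cone of a proper face, since that of \<open>P\<close> is
  \<open>{0}\<close>. A facet containing this face has a nonzero normal cone inside the ray, which
  must be the entire ray.\<close>

lemma ex_facet_of_ray: "\<exists>Q. Q facet_of P \<and> normal_cone P Q = ray U i"
proof -
  obtain F where F: "F face_of P" "F \<noteq> {}" "normal_cone P F = ray U i"
    using ray_in_fan[of i] by (auto simp: normal_fan_def)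
  have "F \<noteq> P"
    using F(3) row_in_ray[of i] row_nonzero[of i] normal_cone_full_dim[OF full_dim] by auto
  then obtain Q where Q: "Q facet_of P" "F \<subseteq> Q"
    using face_of_polyhedron_subset_facet[OF polytope_imp_polyhedron[OF polytope] F(1,2)] by blast
  have Qface: "Q face_of P" "Q \<noteq> {}" "Q \<noteq> P"
    using Q facet_of_imp_face_of by (auto simp: facet_of_def)
  have sub: "normal_cone P Q \<subseteq> ray U i"
    using normal_cone_antimono[OF Q(2)] F by auto
  have "normal_cone P Q \<noteq> {0}"
    using normal_cone_inject[OF polytope Qface(1,2) P_face] normal_cone_full_dim[OF full_dim] Qface(3)
    by auto
  then obtain v where v: "v \<in> normal_cone P Q" "v \<noteq> 0"
    using convex_cone_contains_0[OF convex_cone_normal_cone, of P Q] by blast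
  then have "convex_cone hull {v} = ray U i"
    using sub convex_cone_hull_singleton_eqI unfolding ray_def by blast
  moreover have "convex_cone hull {v} \<subseteq> normal_cone P Q"
    using v by (intro hull_minimal convex_cone_normal_cone) auto
  ultimately show ?thesis using sub Q by blast
qed

lemma ray_facet:
  "ray_facet P U i facet_of P" "normal_cone P (ray_facet P U i) = ray U i"
proof -
  have "\<exists>!Q. Q facet_of P \<and> normal_cone P Q = ray U i"
    using ex_facet_of_ray[of i] normal_cone_inject[OF polytope] by (metis facet_of_def)
  from theI'[OF this] show "ray_facet P U i facet_of P" "normal_cone P (ray_facet P U i) = ray U i"
    by (auto simp: ray_facet_def)
qed

lemma ray_facet_face: "ray_facet P U i face_of P" "ray_facet P U i \<noteq> {}"
  using ray_facet(1)[of i] by (auto simp: facet_of_def)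

lemma in_labels_normal_cone_iff:
  assumes "F face_of P" "F \<noteq> {}"
  shows "i \<in> labels (normal_cone P F) \<longleftrightarrow> F \<subseteq> ray_facet P U i"
proof -
  have "i \<in> labels (normal_cone P F) \<longleftrightarrow> ray U i \<subseteq> normal_cone P F"
    using labels_alt[OF normal_cone_in_fan[OF assms]] row_in_ray[of i] face_of_imp_subset
    by (auto simp: ray_labels_def)
  then show ?thesis
    using normal_cone_subset_iff[OF polytope assms(1) ray_facet_face] by (simp add: ray_facet(2))
qed

lemma labels_normal_cone_mono_iff:
  assumes "F face_of P" "F \<noteq> {}" "G face_of P" "G \<noteq> {}"
  shows "labels (normal_cone P G) \<subseteq> labels (normal_cone P F) \<longleftrightarrow> F \<subseteq> G"
  using labels_mono_iff[OF normal_cone_in_fan[OF assms(1,2)] normal_cone_in_fan[OF assms(3,4)]]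
    normal_cone_subset_iff[OF polytope assms(1,3,4)] by simp

text \<open>A cone containing the ray and the normal cone of \<open>D\<close> is the normal cone of
  a nonempty face of both the facet and \<open>D\<close>. Their intersection, if nonempty, is the
  largest such face.\<close>

lemma nb_normal_cone_iff:
  assumes D: "D face_of P" "D \<noteq> {}"
  shows "i \<in> nb (normal_fan P) U (normal_cone P D) \<longleftrightarrow>
    i \<notin> labels (normal_cone P D) \<and> ray_facet P U i \<inter> D \<noteq> {}"
proof -
  have "(\<exists>\<sigma>\<in>normal_fan P. insert i (labels (normal_cone P D)) \<subseteq> labels \<sigma>) \<longleftrightarrow>
      (\<exists>G. G face_of P \<and> G \<noteq> {} \<and> G \<subseteq> ray_facet P U i \<and> G \<subseteq> D)"
    using in_labels_normal_cone_iff labels_normal_cone_mono_iff[OF _ _ D]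
    by (auto simp: normal_fan_def)
  also have "\<dots> \<longleftrightarrow> ray_facet P U i \<inter> D \<noteq> {}"
    using face_of_Int[OF ray_facet_face(1) D(1), of i] by blast
  finally show ?thesis
    by (simp add: nb_iff[OF normal_cone_in_fan[OF D]])
qed

text \<open>If the facet meets \<open>D\<close> without containing it, the intersection has exactly
  one label more than \<open>D\<close>. This leaves no room for a face strictly between, so the
  intersection is a facet of \<open>D\<close>.\<close>

lemma face_nb_eq_nb:
  assumes D: "D face_of P" "D \<noteq> {}"
  shows "face_nb P U D = nb (normal_fan P) U (normal_cone P D)"
proof (intro equalityI subsetI)
  fix i assume "i \<in> face_nb P U D"
  then have "(ray_facet P U i \<inter> D) facet_of D" by (simp add: face_nb_def)
  then have "ray_facet P U i \<inter> D \<noteq> {}" "\<not> D \<subseteq> ray_facet P U i"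
    by (auto simp: facet_of_def inf_absorb2)
  then show "i \<in> nb (normal_fan P) U (normal_cone P D)"
    using nb_normal_cone_iff[OF D] in_labels_normal_cone_iff[OF D] by blast
next
  fix i assume i: "i \<in> nb (normal_fan P) U (normal_cone P D)"
  let ?L = "\<lambda>F. labels (normal_cone P F)"
  define G where "G = ray_facet P U i \<inter> D"
  have notin: "i \<notin> ?L D" and "G \<noteq> {}"
    using i nb_normal_cone_iff[OF D] by (auto simp: G_def)
  have Gface: "G face_of P"
    unfolding G_def by (intro face_of_Int ray_facet_face D)
  note G = Gface \<open>G \<noteq> {}\<close>
  have sub: "insert i (?L D) \<subseteq> ?L G"
    using labels_normal_cone_mono_iff[OF G D] in_labels_normal_cone_iff[OF G] by (auto simp: G_def)
  note s = subset_labels[OF normal_cone_in_fan[OF G] sub]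
  \<comment> \<open>The face with exactly the labels of \<open>D\<close> and \<open>i\<close>. It
    lies in the facet and in \<open>D\<close>, hence in \<open>G\<close>, which bounds the labels of
    \<open>G\<close> from above.\<close>
  obtain G' where G': "G' face_of P" "G' \<noteq> {}" "normal_cone P G' = cone_over U (insert i (?L D))"
    using s(1) by (auto simp: normal_fan_def)
  have "?L G' = insert i (?L D)"
    using s(2) G'(3) by simp
  then have "G' \<subseteq> G"
    using labels_normal_cone_mono_iff[OF G'(1,2) D] in_labels_normal_cone_iff[OF G'(1,2), of i]
    by (auto simp: G_def)
  then have LG: "?L G = insert i (?L D)"
    using labels_normal_cone_mono_iff[OF G'(1,2) G] \<open>?L G' = insert i (?L D)\<close> sub by auto
  have "G face_of D"
    using G D face_of_face[OF D(1)] by (auto simp: G_def)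
  moreover have "G \<noteq> D" using LG notin by auto
  \<comment> \<open>The labels of \<open>H\<close> lie between those of \<open>D\<close>, strictly,
    and those of \<open>G\<close>, hence equal the latter.\<close>
  ultimately obtain H where H: "H facet_of D" "G \<subseteq> H"
    using face_of_polyhedron_subset_facet[OF polytope_imp_polyhedron] \<open>G \<noteq> {}\<close>
      face_of_polytope_polytope[OF polytope D(1)] by metis
  have Hf: "H face_of P" "H \<noteq> {}" "H \<subseteq> D" "H \<noteq> D"
    using H(1) face_of_trans[OF facet_of_imp_face_of[OF H(1)] D(1)] facet_of_imp_subset[OF H(1)]
    by (auto simp: facet_of_def)
  have "?L D \<subseteq> ?L H" "\<not> ?L H \<subseteq> ?L D" "?L H \<subseteq> ?L G"
    using labels_normal_cone_mono_iff[OF Hf(1,2) D] labels_normal_cone_mono_iff[OF D Hf(1,2)]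
      labels_normal_cone_mono_iff[OF G Hf(1,2)] Hf H by auto
  then have "?L H = ?L G" unfolding LG by blast
  then have "H \<subseteq> G"
    using labels_normal_cone_mono_iff[OF Hf(1,2) G] by simp
  then have "H = G" using H by auto
  then show "i \<in> face_nb P U D"
    using H by (simp add: face_nb_def G_def)
qed

text \<open>The face \<open>F\<close> with the desired normal cone lies in every facet of the
  intersection. The labels of the intersection thus lie between \<open>J - {q}\<close> and the
  labels of \<open>F\<close>, which coincide.\<close>

lemma cofacet:
  assumes J: "primitive_collection (normal_fan P) U J" and q: "q \<in> J"
  shows "cofacet P U J q face_of P" "cofacet P U J q \<noteq> {}"
    "normal_cone P (cofacet P U J q) = cone_over U (J - {q})"
proof -
  let ?D = "cofacet P U J q"
  note \<tau> = primitive_cone[OF J q]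
  obtain F where F: "F face_of P" "F \<noteq> {}" "normal_cone P F = cone_over U (J - {q})"
    using \<tau>(1) by (auto simp: normal_fan_def)
  have LF: "labels (normal_cone P F) = J - {q}"
    using \<tau>(2) F(3) by simp
  then have FD: "F \<subseteq> ?D"
    using in_labels_normal_cone_iff[OF F(1,2)] by (auto simp: cofacet_def)
  show Df: "?D face_of P"
    unfolding cofacet_def using primitive_other_elem[OF J q]
    by (intro face_of_Inter) (auto simp: ray_facet_face)
  show Dn: "?D \<noteq> {}" using FD F(2) by auto
  have "J - {q} \<subseteq> labels (normal_cone P ?D)"
    using in_labels_normal_cone_iff[OF Df Dn] by (auto simp: cofacet_def)
  moreover have "labels (normal_cone P ?D) \<subseteq> labels (normal_cone P F)"
    using labels_normal_cone_mono_iff[OF F(1,2) Df Dn] FD by simp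
  ultimately have "labels (normal_cone P ?D) = labels (cone_over U (J - {q}))"
    using LF \<tau>(2) by auto
  then show "normal_cone P ?D = cone_over U (J - {q})"
    using labels_inject[OF normal_cone_in_fan[OF Df Dn] \<tau>(1)] by simp
qed

lemma face_adjoint_cofacet:
  assumes "primitive_collection (normal_fan P) U J" "q \<in> J"
  shows "face_adjoint P U (cofacet P U J q) T K =
    star_adjoint (normal_fan P) U (cone_over U (J - {q})) T K"
  using face_nb_eq_nb[OF cofacet(1,2)[OF assms]]
  by (simp add: face_adjoint_def star_adjoint_def cofacet(3)[OF assms] fun_eq_iff)

text \<open>For labels in \<open>J - {q}\<close> the equivalence fails: their facets contain the
  face, but they are no neighbours. This is why \<open>i\<close> is taken outside
  \<open>J\<close>.\<close>

lemma disjoint_facets_iff: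
  assumes J: "primitive_collection (normal_fan P) U J" "q \<in> J" and "i \<notin> J"
  shows "ray_facet P U i \<inter> cofacet P U J q = {} \<longleftrightarrow>
    i \<notin> nb (normal_fan P) U (cone_over U (J - {q}))"
  using nb_normal_cone_iff[OF cofacet(1,2)[OF J], of i] \<open>i \<notin> J\<close>
  by (simp add: cofacet(3)[OF J] primitive_cone(2)[OF J])

end

section \<open>The equations for a simplicial fan and for a simple polytope\<close>

theorem proposition7p3:
  fixes \<Sigma> :: "(real^'d) set set" and U :: "real^'d^'n" and J :: "'n set"
  assumes "simplicial_fan \<Sigma>"
    and "ray_matrix \<Sigma> U"
    and "primitive_collection \<Sigma> U J"
  shows "(\<forall>\<rho>\<in>J. cone_over U (J - {\<rho>}) \<in> fan_cones \<Sigma> (card J - 1)) \<and>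
    (\<forall>(T :: 'n \<Rightarrow> real^'d^'d) (K :: 'n \<Rightarrow> 'd set).
       (\<forall>\<rho>\<in>J. adapted U (cone_over U (J - {\<rho>})) (T \<rho>) (K \<rho>)) \<longrightarrow>
       sing_adjoint \<Sigma> U \<inter> coord_subspace J =
       zero_locus
         ({(\<lambda>x. x $ \<rho>) | \<rho>. \<rho> \<in> J} \<union>
          {(\<lambda>x. (\<Prod>\<rho>' | \<rho>' \<notin> nb \<Sigma> U (cone_over U (J - {\<rho>})) \<and> \<rho>' \<notin> J. x $ \<rho>') *
                star_adjoint \<Sigma> U (cone_over U (J - {\<rho>})) (T \<rho>) (K \<rho>) x) | \<rho>. \<rho> \<in> J})) \<and>
    (\<forall>P. simple_polytope P \<and> aff_dim P = int CARD('d) \<and> \<Sigma> = normal_fan P \<longrightarrow>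
       (\<forall>q\<in>J. ray_facet P U q facet_of P \<and> normal_cone P (ray_facet P U q) = ray U q) \<and>
       (\<forall>(T :: 'n \<Rightarrow> real^'d^'d) (K :: 'n \<Rightarrow> 'd set).
          (\<forall>q\<in>J. adapted U (normal_cone P (cofacet P U J q)) (T q) (K q)) \<longrightarrow>
          sing_adjoint (normal_fan P) U \<inter> coord_subspace J =
          zero_locus
            ({(\<lambda>x. x $ q) | q. q \<in> J} \<union>
             {(\<lambda>x. (\<Prod>q' | ray_facet P U q' \<inter> cofacet P U J q = {} \<and> q' \<notin> J. x $ q') *
                   face_adjoint P U (cofacet P U J q) (T q) (K q) x) | q. q \<in> J})))"
proof -
  interpret fan: simplicial_fan_rays \<Sigma> U
    by unfold_locales (use assms in auto)
  show ?thesis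
  proof (intro conjI allI impI; (elim conjE)?)
    show "\<forall>\<rho>\<in>J. cone_over U (J - {\<rho>}) \<in> fan_cones \<Sigma> (card J - 1)"
      using fan.primitive_cone_dim[OF assms(3)] by blast
  next
    fix T :: "'n \<Rightarrow> real^'d^'d" and K :: "'n \<Rightarrow> 'd set"
    assume "\<forall>\<rho>\<in>J. adapted U (cone_over U (J - {\<rho>})) (T \<rho>) (K \<rho>)"
    then show "sing_adjoint \<Sigma> U \<inter> coord_subspace J =
       zero_locus
         ({(\<lambda>x. x $ \<rho>) | \<rho>. \<rho> \<in> J} \<union>
          {(\<lambda>x. (\<Prod>\<rho>' | \<rho>' \<notin> nb \<Sigma> U (cone_over U (J - {\<rho>})) \<and> \<rho>' \<notin> J. x $ \<rho>') *
                star_adjoint \<Sigma> U (cone_over U (J - {\<rho>})) (T \<rho>) (K \<rho>) x) | \<rho>. \<rho> \<in> J})"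
      by (rule fan.sing_adjoint_Int_coord_subspace[OF assms(3)])
  next
    fix P assume P: "simple_polytope P" "aff_dim P = int CARD('d)" and \<Sigma>: "\<Sigma> = normal_fan P"
    interpret nf: polytope_normal_fan P U
      by unfold_locales (use P assms \<Sigma> in \<open>auto simp: simple_polytope_def\<close>)
    show "\<forall>q\<in>J. ray_facet P U q facet_of P \<and> normal_cone P (ray_facet P U q) = ray U q"
      using nf.ray_facet by blast
  next
    fix P and T :: "'n \<Rightarrow> real^'d^'d" and K :: "'n \<Rightarrow> 'd set"
    assume P: "simple_polytope P" "aff_dim P = int CARD('d)" and \<Sigma>: "\<Sigma> = normal_fan P"
      and ad: "\<forall>q\<in>J. adapted U (normal_cone P (cofacet P U J q)) (T q) (K q)"
    interpret nf: polytope_normal_fan P U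
      by unfold_locales (use P assms \<Sigma> in \<open>auto simp: simple_polytope_def\<close>)
    have J: "primitive_collection (normal_fan P) U J"
      using assms \<Sigma> by simp
    let ?f = "\<lambda>q x. (\<Prod>q' | ray_facet P U q' \<inter> cofacet P U J q = {} \<and> q' \<notin> J. x $ q') *
                   face_adjoint P U (cofacet P U J q) (T q) (K q) x"
    let ?g = "\<lambda>q x. (\<Prod>\<rho>' | \<rho>' \<notin> nb (normal_fan P) U (cone_over U (J - {q})) \<and> \<rho>' \<notin> J. x $ \<rho>') *
                star_adjoint (normal_fan P) U (cone_over U (J - {q})) (T q) (K q) x"
    \<comment> \<open>The polytope equations agree with the star equations of the normal fan as
      functions, so the general description carries over.\<close>
    have "?f q = ?g q" if "q \<in> J" for q
    proof -
      have "{q'. ray_facet P U q' \<inter> cofacet P U J q = {} \<and> q' \<notin> J} =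
          {\<rho>'. \<rho>' \<notin> nb (normal_fan P) U (cone_over U (J - {q})) \<and> \<rho>' \<notin> J}"
        using nf.disjoint_facets_iff[OF J that] by blast
      then show ?thesis
        by (simp add: nf.face_adjoint_cofacet[OF J that])
    qed
    then have eq: "{?f q | q. q \<in> J} = {?g q | q. q \<in> J}"
      unfolding Setcompr_eq_image by (intro image_cong) auto
    show "sing_adjoint (normal_fan P) U \<inter> coord_subspace J =
          zero_locus ({(\<lambda>x. x $ q) | q. q \<in> J} \<union> {?f q | q. q \<in> J})"
      unfolding eq
      by (rule nf.sing_adjoint_Int_coord_subspace[OF J])
         (use ad nf.cofacet(3)[OF J] in simp)
  qed
qed

end
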